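(* Let $n\ge 1$ be an integer, let $F\in\mathbb{C}[x_1,\ldots,x_s]$ be a reduced non-constant polynomial, let $X=\mathbf{V}(F)\subset\mathbb{C}^s$ and let $p\in X$. Let $M=\binom{n+s-1}{s}$. Then $$p \text{ is a non-singular point of } X \iff \operatorname{rank}\,\mathrm{Jac}_n(F)_{|p}=M.$$
   Context: $\mathbb{N}=\{0,1,2,\ldots\}$. For $\alpha,\beta\in\mathbb{N}^s$: $|\alpha|=\alpha_1+\cdots+\alpha_s$, $\alpha!=\alpha_1!\cdots\alpha_s!$, $\binom{\alpha}{\beta}=\prod_i\binom{\alpha_i}{\beta_i}$, $\alpha\le\beta$ means $\alpha_i\le\beta_i$ for all $i$, and $\partial^\alpha=\partial^{\alpha_1}_{x_1}\cdots\partial^{\alpha_s}_{x_s}$. Convention: $\partial^{\alpha-\beta}F=0$ if $\alpha_i<\beta_i$ for some $i$. Multi-indices are ordered increasingly by graded lexicographical order with $x_1<x_2<\cdots<x_s$: $\alpha<_{grlex}\beta$ iff $|\alpha|<|\beta|$, or $|\alpha|=|\beta|$ and $\alpha_i<\beta_i$ for the largest index $i$ with $\alpha_i\neq\beta_i$. Let $N=\binom{n+s}{s}$ and $M=\binom{n+s-1}{s}$. For $\beta\in\mathbb{N}^s$ with $0\le|\beta|\le n-1$ put $r_\beta:=\beta!\cdot\Big(\binom{\alpha}{\beta}\frac{\partial^{\alpha-\beta}F}{\alpha!}\ \Big|\ 1\le|\alpha|\le n\Big)$, a vector of $N-1$ polynomials with entries ordered increasingly in $\alpha$ by the graded lexicographical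 order $<_{grlex}$ (so its $\alpha$-entry is $\frac{\partial^{\alpha-\beta}F}{(\alpha-\beta)!}$ if $\alpha\ge\beta$ and $0$ otherwise). The Jacobian matrix of order $n$ of $F$, $\mathrm{Jac}_n(F)$, is the $M\times(N-1)$ matrix whose rows are the $M$ vectors $r_\beta$, ordered increasingly in $\beta$. $\mathrm{Jac}_n(F)_{|p}$ is the complex matrix obtained by evaluating the entries at $p$. *)

theory Defs
  imports
    "HOL-Analysis.Analysis"
    "HOL-Library.Poly_Mapping"
    "HOL-Library.Extended_Nat"
    "HOL-Computational_Algebra.Squarefree"
    "Jordan_Normal_Form.DL_Rank"
begin

text \<open>From here on \<open>$\<close> is the component of a point of \<open>complex ^ 's\<close>, not of a
  \<open>Matrix.vec\<close>.\<close>

no_notation Matrix.vec_index (infixl "$" 100)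

subsection \<open>Polynomials\<close>

text \<open>The variables are indexed by a finite linearly ordered type \<open>'s\<close>; the ring
  \<open>'s cpoly\<close> is the monoid algebra of the multi-indices over the complex numbers.
  Its multiplication, divisibility and units are those of \<open>HOL-Library.Poly_Mapping\<close>.
  Pitfall: the order \<open>\<le>\<close> that \<open>Poly_Mapping\<close> puts on multi-indices is a lexicographic
  one, hence the separate relation \<open>mi_le\<close> below.\<close>

type_synonym 's mindex = "'s \<Rightarrow>\<^sub>0 nat"
type_synonym 's cpoly = "('s \<Rightarrow>\<^sub>0 nat) \<Rightarrow>\<^sub>0 complex"

definition const_poly :: "complex \<Rightarrow> 's cpoly" where
  "const_poly c = Poly_Mapping.single 0 c"

definition poly_eval :: "'s::finite cpoly \<Rightarrow> complex ^ 's \<Rightarrow> complex" where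
  "poly_eval F p =
     (\<Sum>m\<in>Poly_Mapping.keys F.
        Poly_Mapping.lookup F m * (\<Prod>i\<in>UNIV. (p $ i) ^ Poly_Mapping.lookup m i))"

text \<open>In the summands with \<open>lookup m i = 0\<close> the subtraction is truncated, but the
  coefficient vanishes.\<close>

definition partial_deriv :: "'s \<Rightarrow> 's cpoly \<Rightarrow> 's cpoly" where
  "partial_deriv i F =
     (\<Sum>m\<in>Poly_Mapping.keys F.
        Poly_Mapping.single (m - Poly_Mapping.single i 1)
          (of_nat (Poly_Mapping.lookup m i) * Poly_Mapping.lookup F m))"

definition mi_deriv :: "'s::{finite,linorder} mindex \<Rightarrow> 's cpoly \<Rightarrow> 's cpoly" where
  "mi_deriv \<alpha> F =
     foldr (\<lambda>i. partial_deriv i ^^ Poly_Mapping.lookup \<alpha> i) (sorted_list_of_set UNIV) F"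

subsection \<open>Multi-indices\<close>

definition mi_deg :: "'s::finite mindex \<Rightarrow> nat" where
  "mi_deg \<alpha> = (\<Sum>i\<in>UNIV. Poly_Mapping.lookup \<alpha> i)"

definition mi_fact :: "'s::finite mindex \<Rightarrow> nat" where
  "mi_fact \<alpha> = (\<Prod>i\<in>UNIV. fact (Poly_Mapping.lookup \<alpha> i))"

definition mi_binomial :: "'s::finite mindex \<Rightarrow> 's mindex \<Rightarrow> nat" where
  "mi_binomial \<alpha> \<beta> =
     (\<Prod>i\<in>UNIV. Poly_Mapping.lookup \<alpha> i choose Poly_Mapping.lookup \<beta> i)"

definition mi_le :: "'s mindex \<Rightarrow> 's mindex \<Rightarrow> bool" where
  "mi_le \<beta> \<alpha> \<longleftrightarrow> (\<forall>i. Poly_Mapping.lookup \<beta> i \<le> Poly_Mapping.lookup \<alpha> i)"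

definition grlex_less :: "'s::{finite,linorder} mindex \<Rightarrow> 's mindex \<Rightarrow> bool" where
  "grlex_less \<alpha> \<beta> \<longleftrightarrow>
     mi_deg \<alpha> < mi_deg \<beta> \<or>
     (mi_deg \<alpha> = mi_deg \<beta> \<and>
      (\<exists>i. Poly_Mapping.lookup \<alpha> i < Poly_Mapping.lookup \<beta> i \<and>
           (\<forall>j>i. Poly_Mapping.lookup \<alpha> j = Poly_Mapping.lookup \<beta> j)))"

definition grlex_list :: "'s::{finite,linorder} mindex set \<Rightarrow> 's mindex list" where
  "grlex_list S = (THE as. sorted_wrt grlex_less as \<and> set as = S)"

text \<open>The description in \<open>grlex_list\<close> is a proper one for the finite sets it is used on.\<close>

lemma linorder_grlex:
  "class.linorder (\<lambda>\<alpha> \<beta>. grlex_less \<alpha> \<beta> \<or> \<alpha> = \<beta>)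
     (grlex_less :: 's::{finite,linorder} mindex \<Rightarrow> _)"
proof -
  have irr: "\<not> grlex_less \<alpha> \<alpha>" for \<alpha> :: "'s mindex"
    by (auto simp: grlex_less_def)
  have tr: "grlex_less \<alpha> \<gamma>" if 1: "grlex_less \<alpha> \<beta>" and 2: "grlex_less \<beta> \<gamma>"
    for \<alpha> \<beta> \<gamma> :: "'s mindex"
  proof (cases "mi_deg \<alpha> = mi_deg \<beta> \<and> mi_deg \<beta> = mi_deg \<gamma>")
    case True
    obtain i where i: "Poly_Mapping.lookup \<alpha> i < Poly_Mapping.lookup \<beta> i"
      "\<forall>j>i. Poly_Mapping.lookup \<alpha> j = Poly_Mapping.lookup \<beta> j"
      using 1 True by (auto simp: grlex_less_def)
    obtain k where k: "Poly_Mapping.lookup \<beta> k < Poly_Mapping.lookup \<gamma> k"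
      "\<forall>j>k. Poly_Mapping.lookup \<beta> j = Poly_Mapping.lookup \<gamma> j"
      using 2 True by (auto simp: grlex_less_def)
    have "Poly_Mapping.lookup \<alpha> (max i k) < Poly_Mapping.lookup \<gamma> (max i k) \<and>
      (\<forall>j>max i k. Poly_Mapping.lookup \<alpha> j = Poly_Mapping.lookup \<gamma> j)"
    proof (cases i k rule: linorder_cases)
      case less then show ?thesis using i k by (simp add: max_def)
    next
      case equal then show ?thesis using i k by (auto simp: max_def)
    next
      case greater then show ?thesis using i k by (auto simp: max_def)
    qed
    then have "\<exists>i. Poly_Mapping.lookup \<alpha> i < Poly_Mapping.lookup \<gamma> i \<and>
      (\<forall>j>i. Poly_Mapping.lookup \<alpha> j = Poly_Mapping.lookup \<gamma> j)" by (rule exI)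
    with True show ?thesis unfolding grlex_less_def by metis
  next
    case False
    have "mi_deg \<alpha> \<le> mi_deg \<beta>" "mi_deg \<beta> \<le> mi_deg \<gamma>"
      using 1 2 unfolding grlex_less_def by linarith+
    with False have "mi_deg \<alpha> < mi_deg \<gamma>" by linarith
    then show ?thesis unfolding grlex_less_def by (rule disjI1)
  qed
  have tot: "grlex_less \<alpha> \<beta> \<or> \<alpha> = \<beta> \<or> grlex_less \<beta> \<alpha>" for \<alpha> \<beta> :: "'s mindex"
  proof (cases "\<alpha> = \<beta>")
    case False
    let ?D = "{i. Poly_Mapping.lookup \<alpha> i \<noteq> Poly_Mapping.lookup \<beta> i}"
    obtain d where d: "d = Max ?D" by blast
    have fin: "finite ?D" by (rule finite)
    have "?D \<noteq> {}" using False poly_mapping_eqI[of \<alpha> \<beta>] by blast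
    then have m: "d \<in> ?D" unfolding d by (rule Max_in[OF fin])
    have *: "\<forall>j>d. Poly_Mapping.lookup \<alpha> j = Poly_Mapping.lookup \<beta> j"
    proof (intro allI impI)
      fix j assume "j > d"
      then have "j \<notin> ?D" using Max_ge[OF fin, of j] unfolding d[symmetric] by (meson leD)
      then show "Poly_Mapping.lookup \<alpha> j = Poly_Mapping.lookup \<beta> j" by blast
    qed
    from m have "Poly_Mapping.lookup \<alpha> d \<noteq> Poly_Mapping.lookup \<beta> d" by (rule CollectD)
    then have "Poly_Mapping.lookup \<alpha> d < Poly_Mapping.lookup \<beta> d \<or>
      Poly_Mapping.lookup \<beta> d < Poly_Mapping.lookup \<alpha> d" by linarith
    then have "(\<exists>i. Poly_Mapping.lookup \<alpha> i < Poly_Mapping.lookup \<beta> i \<and>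
        (\<forall>j>i. Poly_Mapping.lookup \<alpha> j = Poly_Mapping.lookup \<beta> j)) \<or>
      (\<exists>i. Poly_Mapping.lookup \<beta> i < Poly_Mapping.lookup \<alpha> i \<and>
        (\<forall>j>i. Poly_Mapping.lookup \<beta> j = Poly_Mapping.lookup \<alpha> j))"
      using * by metis
    then show ?thesis
      unfolding grlex_less_def by (metis linorder_neqE_nat)
  qed simp
  show ?thesis
  proof (rule class.linorder.intro[OF class.order.intro[OF class.preorder.intro]])
    show "class.order_axioms (\<lambda>\<alpha> \<beta>. grlex_less \<alpha> \<beta> \<or> \<alpha> = (\<beta> :: 's mindex))"
      by unfold_locales (use irr tr in metis)
    show "class.linorder_axioms (\<lambda>\<alpha> \<beta>. grlex_less \<alpha> \<beta> \<or> \<alpha> = (\<beta> :: 's mindex))"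
      by unfold_locales (use tot in metis)
  qed (use irr tr in metis)+
qed

lemma grlex_list_ex1:
  assumes "finite (S :: 's::{finite,linorder} mindex set)"
  shows "\<exists>!as. sorted_wrt grlex_less as \<and> set as = S"
  by (rule linorder.ex1_sorted_list_for_set_if_finite[OF linorder_grlex assms])

subsection \<open>The Jacobian matrix of order \<open>n\<close>\<close>

text \<open>The \<open>else\<close> branch is the convention that \<open>mi_deriv (\<alpha> - \<beta>) F\<close> means \<open>0\<close>
  when \<open>\<beta>\<close> is not componentwise below \<open>\<alpha>\<close>.\<close>

definition jac_entry :: "'s::{finite,linorder} cpoly \<Rightarrow> 's mindex \<Rightarrow> 's mindex \<Rightarrow> 's cpoly" where
  "jac_entry F \<beta> \<alpha> =
     (if mi_le \<beta> \<alpha>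
      then const_poly (of_nat (mi_fact \<beta>) * of_nat (mi_binomial \<alpha> \<beta>) / of_nat (mi_fact \<alpha>))
           * mi_deriv (\<alpha> - \<beta>) F
      else 0)"

definition jac_row :: "nat \<Rightarrow> 's::{finite,linorder} cpoly \<Rightarrow> 's mindex \<Rightarrow> 's cpoly Matrix.vec" where
  "jac_row n F \<beta> =
     vec_of_list (map (jac_entry F \<beta>) (grlex_list {\<alpha>. 1 \<le> mi_deg \<alpha> \<and> mi_deg \<alpha> \<le> n}))"

definition Jac :: "nat \<Rightarrow> 's::{finite,linorder} cpoly \<Rightarrow> 's cpoly Matrix.mat" where
  "Jac n F =
     mat_of_rows (((n + CARD('s)) choose CARD('s)) - 1)
       (map (jac_row n F) (grlex_list {\<beta>. mi_deg \<beta> \<le> n - 1}))"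

definition Jac_at ::
  "nat \<Rightarrow> 's::{finite,linorder} cpoly \<Rightarrow> complex ^ ('s::{finite,linorder}) \<Rightarrow> complex Matrix.mat" where
  "Jac_at n F p = map_mat (\<lambda>G. poly_eval G p) (Jac n F)"

definition mat_rank :: "complex Matrix.mat \<Rightarrow> nat" where
  "mat_rank A = vec_space.rank (dim_row A) A"

subsection \<open>Algebraic sets and their non-singular points\<close>

definition zero_set :: "'s::finite cpoly set \<Rightarrow> (complex ^ 's) set" where
  "zero_set S = {q. \<forall>G\<in>S. poly_eval G q = 0}"

definition vanishing_ideal :: "(complex ^ 's::finite) set \<Rightarrow> 's cpoly set" where
  "vanishing_ideal X = {G. \<forall>q\<in>X. poly_eval G q = 0}"

definition alg_closed_set :: "(complex ^ 's::finite) set \<Rightarrow> bool" where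
  "alg_closed_set Z \<longleftrightarrow> (\<exists>S. Z = zero_set S)"

definition alg_irreducible :: "(complex ^ 's::finite) set \<Rightarrow> bool" where
  "alg_irreducible Z \<longleftrightarrow>
     alg_closed_set Z \<and> Z \<noteq> {} \<and>
     (\<forall>Z1 Z2. alg_closed_set Z1 \<longrightarrow> alg_closed_set Z2 \<longrightarrow> Z = Z1 \<union> Z2 \<longrightarrow> Z = Z1 \<or> Z = Z2)"

text \<open>The dimension of \<open>X\<close> at \<open>p\<close>: the supremum of the lengths \<open>r\<close> of chains
  \<open>Z 0 \<subset> \<dots> \<subset> Z r\<close> of irreducible closed subsets of \<open>X\<close> containing \<open>p\<close>, i.e. the Krull
  dimension of the local ring of \<open>X\<close> at \<open>p\<close>.\<close>

definition local_dim :: "(complex ^ 's::finite) set \<Rightarrow> complex ^ 's \<Rightarrow> enat" where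
  "local_dim X p =
     Sup {enat r | r. \<exists>Z. (\<forall>i\<le>r. alg_irreducible (Z i) \<and> p \<in> Z i \<and> Z i \<subseteq> X) \<and>
                          (\<forall>i<r. Z i \<subset> Z (Suc i))}"

text \<open>The Zariski tangent space is cut out by all polynomials vanishing on \<open>X\<close>, not just by
  a chosen equation of \<open>X\<close>.\<close>

definition tangent_space :: "(complex ^ 's::finite) set \<Rightarrow> complex ^ 's \<Rightarrow> (complex ^ 's) set" where
  "tangent_space X p =
     {v. \<forall>G\<in>vanishing_ideal X. (\<Sum>i\<in>UNIV. poly_eval (partial_deriv i G) p * v $ i) = 0}"

text \<open>\<open>vec.dim\<close> is the dimension over the complex numbers (\<open>dim\<close> would be the real one).\<close>

definition nonsingular_point :: "(complex ^ 's::finite) set \<Rightarrow> complex ^ 's \<Rightarrow> bool" where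
  "nonsingular_point X p \<longleftrightarrow>
     p \<in> X \<and> enat (vec.dim (tangent_space X p)) = local_dim X p"

end

theory Submission
  imports Defs "HOL-Computational_Algebra.Fundamental_Theorem_Algebra"
begin

text \<open>Write \<open>s\<close> for the number of variables. Both sides of the equivalence say that the gradient
  of \<open>F\<close> at \<open>p\<close> is not zero.

  The matrix side. Up to the factor \<open>1 / (\<alpha> - \<beta>)!\<close>, the entry in row \<open>\<beta>\<close> and column \<open>\<alpha>\<close> is
  \<open>\<partial>\<^sup>\<alpha>\<^sup>-\<^sup>\<beta> F (p)\<close>, so row \<open>\<beta>\<close> lists the Taylor coefficients at \<open>p\<close> of \<open>(x - p)\<^sup>\<beta> F\<close> in the degrees
  from \<open>1\<close> to \<open>n\<close>.
  If the gradient vanishes, then \<open>F\<close> has order at least two at \<open>p\<close> and the rows with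
  \<open>|\<beta>| = n - 1\<close> are zero. If it does not, then multiplication by \<open>F\<close> raises the order at \<open>p\<close>
  by exactly one, so no non-trivial combination of the rows is zero
  (\<open>left_kernel_trivial\<close>, \<open>mat_rank_Jac_at_iff\<close>). The binomial coefficient is the number
  of rows.

  The geometric side. The tangent space is the kernel of the gradient because every polynomial
  that vanishes on the hypersurface is a multiple of the square-free \<open>F\<close>
  (\<open>squarefree_dvd_if_vanishing\<close>). This rests on two facts about polynomials in one variable
  \<open>x\<^sub>j\<close> over the others: irreducible polynomials are prime (\<open>irreducible_imp_prime\<close>,
  an induction on the number of variables in the manner of Gauss), and an irreducible \<open>f\<close>
  that involves \<open>x\<^sub>j\<close> and does not divide \<open>G\<close> admits a non-zero combination of \<open>f\<close> and \<open>G\<close> free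
  of \<open>x\<^sub>j\<close> (\<open>elimination\<close>), which a common zero over a generic value of the other variables
  contradicts.

  It remains to compare \<open>s\<close> or \<open>s - 1\<close>, the dimension of the tangent space, with the local
  dimension. The latter is always at most \<open>s - 1\<close>: a chain of irreducible closed sets that
  ends in the whole space yields as many algebraically independent polynomials as it has
  inclusions, and counting monomials allows at most \<open>s\<close> of them (\<open>chain_length_bound\<close>). Hence a
  point with zero gradient is singular. At a point with non-zero gradient a chain of length
  \<open>s - 1\<close> is found by freezing one coordinate after the other at its value in \<open>p\<close>, each time
  passing to the irreducible factor through \<open>p\<close> (\<open>smooth_chain_exists\<close>).\<close>

abbreviation lk where "lk \<equiv> Poly_Mapping.lookup"
abbreviation mkeys where "mkeys \<equiv> Poly_Mapping.keys"
abbreviation mterm where "mterm \<equiv> Poly_Mapping.single"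

section \<open>Evaluation\<close>

lemma cpoly_eq_sum_monomials: "(F::'a \<Rightarrow>\<^sub>0 'b::comm_monoid_add) = (\<Sum>m\<in>mkeys F. mterm m (lk F m))"
  by (rule poly_mapping_eqI) (simp add: lookup_sum lookup_single when_def not_in_keys_iff_lookup_eq_zero)

lemma cpoly_induct [case_names zero monomial plus]:
  fixes F :: "'a \<Rightarrow>\<^sub>0 'b::comm_monoid_add"
  assumes "P 0" and "\<And>m c. P (mterm m c)" and "\<And>F G. P F \<Longrightarrow> P G \<Longrightarrow> P (F + G)"
  shows "P F"
proof -
  have "P (\<Sum>m\<in>A. mterm m (lk F m))" if "finite A" for A
    using that by (induction A rule: finite_induct) (auto intro: assms)
  then show ?thesis by (subst cpoly_eq_sum_monomials) simp
qed

definition mono_eval :: "'s::finite mindex \<Rightarrow> complex ^ 's \<Rightarrow> complex" where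
  "mono_eval m p = (\<Prod>i\<in>UNIV. (p $ i) ^ lk m i)"

lemma mono_eval_zero [simp]: "mono_eval 0 p = 1"
  by (simp add: mono_eval_def)

lemma mono_eval_add: "mono_eval (m + m') p = mono_eval m p * mono_eval m' p"
  by (simp add: mono_eval_def lookup_add power_add prod.distrib)

lemma mono_eval_single [simp]: "mono_eval (mterm i k) p = (p $ i) ^ k"
proof -
  have "mono_eval (mterm i k) p = (\<Prod>j\<in>UNIV. if j = i then (p $ i) ^ k else 1)"
    unfolding mono_eval_def by (rule prod.cong) (auto simp: lookup_single when_def)
  then show ?thesis by simp
qed

text \<open>The index set of the defining sum depends on the polynomial; a common index set for two polynomials
  makes additivity visible.\<close>

lemma poly_eval_superset:
  assumes "finite A" "mkeys F \<subseteq> A"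
  shows "poly_eval F p = (\<Sum>m\<in>A. lk F m * mono_eval m p)"
  unfolding poly_eval_def mono_eval_def
  using assms by (intro sum.mono_neutral_left) (auto simp: in_keys_iff)

lemma poly_eval_add [simp]: "poly_eval (F + G) p = poly_eval F p + poly_eval G p"
proof -
  let ?A = "mkeys F \<union> mkeys G"
  have "mkeys (F + G) \<subseteq> ?A" by (rule Poly_Mapping.keys_add)
  then show ?thesis
    by (simp add: poly_eval_superset[of ?A] lookup_add distrib_right sum.distrib)
qed

lemma poly_eval_monomial [simp]: "poly_eval (mterm m c) p = c * mono_eval m p"
  by (simp add: poly_eval_superset[of "{m}"])

lemma poly_eval_zero [simp]: "poly_eval 0 p = 0"
  by (simp add: poly_eval_def)

lemma poly_eval_mult [simp]: "poly_eval (F * G) p = poly_eval F p * poly_eval G p"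
proof (induction F rule: cpoly_induct)
  case (monomial m c)
  show ?case
    by (induction G rule: cpoly_induct)
      (simp_all add: mult_single mono_eval_add distrib_left)
qed (simp_all add: distrib_right)

lemma poly_eval_const [simp]: "poly_eval (const_poly c) p = c"
  by (simp add: const_poly_def)

lemma poly_eval_one [simp]: "poly_eval 1 p = 1"
  by (metis const_poly_def poly_eval_const single_one)

lemma poly_eval_power [simp]: "poly_eval (F ^ k) p = poly_eval F p ^ k"
  by (induction k) simp_all

lemma poly_eval_uminus [simp]: "poly_eval (- F) p = - poly_eval F p"
  using poly_eval_add[of F "- F" p] by (simp add: eq_neg_iff_add_eq_0 add.commute)

lemma poly_eval_minus [simp]: "poly_eval (F - G) p = poly_eval F p - poly_eval G p"
  using poly_eval_add[of F "- G" p] by simp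

lemma poly_eval_sum: "poly_eval (\<Sum>a\<in>A. F a) p = (\<Sum>a\<in>A. poly_eval (F a) p)"
  by (induction A rule: infinite_finite_induct) simp_all

definition point_upd :: "complex ^ 's \<Rightarrow> 's \<Rightarrow> complex \<Rightarrow> complex ^ 's" where
  "point_upd p j t = (\<chi> i. if i = j then t else p $ i)"

lemma point_upd_nth [simp]: "point_upd p j t $ i = (if i = j then t else p $ i)"
  by (simp add: point_upd_def)

lemma point_upd_same [simp]: "point_upd p j (p $ j) = p"
  by (simp add: Finite_Cartesian_Product.vec_eq_iff)

section \<open>Variables and degree in one variable\<close>

definition vars_in :: "'s set \<Rightarrow> 's cpoly \<Rightarrow> bool" where
  "vars_in S F \<longleftrightarrow> (\<forall>m\<in>mkeys F. mkeys m \<subseteq> S)"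

definition deg_lt :: "'s \<Rightarrow> nat \<Rightarrow> 's cpoly \<Rightarrow> bool" where
  "deg_lt j d F \<longleftrightarrow> (\<forall>m\<in>mkeys F. lk m j < d)"

abbreviation (input) xpow :: "'s \<Rightarrow> nat \<Rightarrow> 's cpoly" where
  "xpow j k \<equiv> mterm (mterm j k) 1"

lemma vars_in_zero [simp]: "vars_in S 0" by (simp add: vars_in_def)

lemma vars_in_UNIV [simp]: "vars_in UNIV F" by (simp add: vars_in_def)

lemma vars_in_mono: "vars_in S F \<Longrightarrow> S \<subseteq> T \<Longrightarrow> vars_in T F"
  by (auto simp: vars_in_def)

lemma vars_in_add: "vars_in S F \<Longrightarrow> vars_in S G \<Longrightarrow> vars_in S (F + G)"
  unfolding vars_in_def using Poly_Mapping.keys_add[of F G] by blast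

lemma vars_in_uminus [simp]: "vars_in S (- F) \<longleftrightarrow> vars_in S F"
  by (simp add: vars_in_def in_keys_iff)

lemma vars_in_minus: "vars_in S F \<Longrightarrow> vars_in S G \<Longrightarrow> vars_in S (F - G)"
  using vars_in_add[of S F "- G"] by simp

lemma vars_in_mult: "vars_in S F \<Longrightarrow> vars_in S G \<Longrightarrow> vars_in S (F * G)"
proof -
  assume F: "vars_in S F" and G: "vars_in S G"
  have "mkeys m \<subseteq> S" if m: "m \<in> mkeys (F * G)" for m
  proof -
    obtain a b where "m = a + b" "a \<in> mkeys F" "b \<in> mkeys G"
      using m Poly_Mapping.keys_mult[of F G] by blast
    then show ?thesis using F G Poly_Mapping.keys_add[of a b] unfolding vars_in_def by blast
  qed
  then show ?thesis by (simp add: vars_in_def)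
qed

lemma vars_in_sum: "(\<And>a. a \<in> A \<Longrightarrow> vars_in S (F a)) \<Longrightarrow> vars_in S (sum F A)"
  by (induction A rule: infinite_finite_induct) (auto intro: vars_in_add)

lemma vars_in_monomial: "mkeys m \<subseteq> S \<Longrightarrow> vars_in S (mterm m c)"
  by (simp add: vars_in_def)

lemma vars_in_xpow: "j \<in> S \<Longrightarrow> vars_in S (xpow j k)"
  by (simp add: vars_in_def)

lemma vars_in_const [simp]: "vars_in S (const_poly c)"
  by (simp add: vars_in_def const_poly_def)

lemma vars_in_one [simp]: "vars_in S 1"
  by (simp add: vars_in_def)

lemma vars_in_iff_forall: "vars_in S F \<longleftrightarrow> (\<forall>j. j \<notin> S \<longrightarrow> vars_in (- {j}) F)"
  unfolding vars_in_def by (auto simp: subset_iff)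

lemma vars_in_empty_iff: "vars_in {} F \<longleftrightarrow> (\<exists>c. F = const_poly c)"
proof
  assume "vars_in {} F"
  then have "mkeys F \<subseteq> {0}" by (auto simp: vars_in_def)
  then have "F = const_poly (lk F 0)"
    by (intro poly_mapping_eqI) (auto simp: const_poly_def lookup_single when_def in_keys_iff)
  then show "\<exists>c. F = const_poly c" ..
qed auto

lemma vars_in_remove_iff: "vars_in (- {j}) F \<longleftrightarrow> (\<forall>m\<in>mkeys F. lk m j = 0)"
  by (auto simp: vars_in_def in_keys_iff)

lemma deg_lt_zero [simp]: "deg_lt j d 0" by (simp add: deg_lt_def)

lemma deg_lt_0_iff [simp]: "deg_lt j 0 F \<longleftrightarrow> F = 0"
  by (metis all_not_in_conv deg_lt_def keys_eq_empty not_less0)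

lemma deg_lt_mono: "deg_lt j d F \<Longrightarrow> d \<le> e \<Longrightarrow> deg_lt j e F"
  by (auto simp: deg_lt_def)

lemma deg_lt_add: "deg_lt j d F \<Longrightarrow> deg_lt j d G \<Longrightarrow> deg_lt j d (F + G)"
  unfolding deg_lt_def using Poly_Mapping.keys_add[of F G] by blast

lemma deg_lt_uminus [simp]: "deg_lt j d (- F) \<longleftrightarrow> deg_lt j d F"
  by (simp add: deg_lt_def in_keys_iff)

lemma deg_lt_minus: "deg_lt j d F \<Longrightarrow> deg_lt j d G \<Longrightarrow> deg_lt j d (F - G)"
  using deg_lt_add[of j d F "- G"] by simp

lemma deg_lt_mult: "deg_lt j d F \<Longrightarrow> deg_lt j (Suc e) G \<Longrightarrow> deg_lt j (d + e) (F * G)"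
proof -
  assume F: "deg_lt j d F" and G: "deg_lt j (Suc e) G"
  have "lk m j < d + e" if m: "m \<in> mkeys (F * G)" for m
  proof -
    obtain a b where "m = a + b" "a \<in> mkeys F" "b \<in> mkeys G"
      using m Poly_Mapping.keys_mult[of F G] by blast
    then show ?thesis using F G by (fastforce simp: deg_lt_def lookup_add)
  qed
  then show ?thesis by (simp add: deg_lt_def)
qed

lemma deg_lt_free: "vars_in (- {j}) F \<Longrightarrow> deg_lt j (Suc 0) F"
  by (auto simp: vars_in_remove_iff deg_lt_def)

lemma deg_lt_xpow: "deg_lt j (Suc k) (xpow j k)"
  by (simp add: deg_lt_def)

lemma deg_lt_free_times_xpow: "vars_in (- {j}) c \<Longrightarrow> deg_lt j (Suc k) (c * xpow j k)"
  using deg_lt_mult[OF deg_lt_free deg_lt_xpow] by simp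

lemma lookup_keys_free_times_xpow:
  assumes "vars_in (- {j}) c" "m \<in> mkeys (c * xpow j k)"
  shows "lk m j = k"
proof -
  obtain a b where "m = a + b" "a \<in> mkeys c" "b \<in> mkeys (xpow j k)"
    using assms(2) Poly_Mapping.keys_mult by blast
  then show ?thesis using assms(1) by (simp add: lookup_add vars_in_remove_iff)
qed

lemma xpow_nonzero [simp]: "xpow j k \<noteq> 0"
  by (metis keys_single empty_not_insert keys_zero zero_neq_one)

lemma xpow_add: "xpow j (k + l) = xpow j k * xpow j l"
  by (simp add: mult_single single_add)

text \<open>Every monomial of \<open>c x\<^sub>j\<^sup>k\<close> has degree exactly \<open>k\<close> in \<open>x\<^sub>j\<close> when \<open>c\<close> is free of \<open>x\<^sub>j\<close>. This is what makes leading
  terms unique.\<close>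

lemma free_coeff_zero:
  fixes c :: "'s::{finite,linorder} cpoly"
  assumes "vars_in (- {j}) c" "deg_lt j k (c * xpow j k)"
  shows "c = 0"
proof -
  have "mkeys (c * xpow j k) = {}"
    using assms lookup_keys_free_times_xpow[OF assms(1)] by (fastforce simp: deg_lt_def)
  then have "c * xpow j k = 0" by simp
  then show ?thesis by simp
qed

text \<open>The leading term \<open>c x\<^sub>j\<^sup>d\<close> of \<open>F\<close> as a polynomial in \<open>x\<^sub>j\<close>. The coefficient \<open>c\<close> is a polynomial in
  the other variables, so that all of one-variable polynomial algebra over the ring of
  the remaining variables takes place inside one type and the induction on the number of variables
  can run over sets of variables.\<close>

definition top_term :: "'s \<Rightarrow> nat \<Rightarrow> 's cpoly \<Rightarrow> 's cpoly \<Rightarrow> bool" where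
  "top_term j d c F \<longleftrightarrow> c \<noteq> 0 \<and> vars_in (- {j}) c \<and> deg_lt j d (F - c * xpow j d)"

lemma top_term_exists:
  fixes F :: "'s::{finite,linorder} cpoly"
  assumes "F \<noteq> 0" "vars_in S F"
  obtains d c where "top_term j d c F" "vars_in (S - {j}) c"
proof -
  define d where "d = Max ((\<lambda>m. lk m j) ` mkeys F)"
  define c where "c = (\<Sum>m\<in>{m \<in> mkeys F. lk m j = d}. mterm (m - mterm j d) (lk F m))"
  have ne: "(\<lambda>m. lk m j) ` mkeys F \<noteq> {}" using assms(1) by simp
  have le: "lk m j \<le> d" if "m \<in> mkeys F" for m
    unfolding d_def using that by (intro Max_ge) auto
  have "d \<in> (\<lambda>m. lk m j) ` mkeys F" unfolding d_def by (rule Max_in) (use ne in auto)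
  then obtain m0 where m0: "m0 \<in> mkeys F" "lk m0 j = d" by auto
  \<comment> \<open>Subtraction of multi-indices is truncated; it is undone by addition only for exponents
    that are at least \<open>d\<close>.\<close>
  have split: "m - mterm j d + mterm j d = m" if "lk m j = d" for m :: "'s mindex"
    using that by (intro poly_mapping_eqI) (auto simp: lookup_add lookup_minus lookup_single when_def)
  define A where "A = (\<Sum>m\<in>{m \<in> mkeys F. lk m j = d}. mterm m (lk F m))"
  define B where "B = (\<Sum>m\<in>{m \<in> mkeys F. lk m j \<noteq> d}. mterm m (lk F m))"
  have "c * xpow j d = A"
    unfolding c_def A_def sum_distrib_right by (intro sum.cong) (simp_all add: mult_single split)
  moreover have "F = A + B"
  proof -
    have "mkeys F \<inter> {m. lk m j = d} = {m \<in> mkeys F. lk m j = d}"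
      "mkeys F - {m. lk m j = d} = {m \<in> mkeys F. lk m j \<noteq> d}" by auto
    then have "(\<Sum>m\<in>mkeys F. mterm m (lk F m)) = A + B"
      using sum.Int_Diff[OF finite_keys, of "\<lambda>m. mterm m (lk F m)" F "{m. lk m j = d}"]
      by (simp only: A_def B_def)
    then show ?thesis by (simp only: cpoly_eq_sum_monomials[of F, symmetric])
  qed
  ultimately have rest: "F - c * xpow j d = B" by simp
  have "mkeys (F - c * xpow j d) \<subseteq> {m \<in> mkeys F. lk m j \<noteq> d}"
    unfolding rest B_def by (rule order.trans[OF Poly_Mapping.keys_sum]) auto
  then have deg: "deg_lt j d (F - c * xpow j d)"
    unfolding deg_lt_def using le by (simp add: subset_iff le_neq_implies_less)
  have "vars_in (S - {j}) (mterm (m - mterm j d) (lk F m))" if "m \<in> mkeys F" "lk m j = d" for m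
  proof (rule vars_in_monomial)
    have "mkeys m \<subseteq> S" using assms(2) that by (auto simp: vars_in_def)
    then show "mkeys (m - mterm j d) \<subseteq> S - {j}"
      using that(2) by (auto simp: in_keys_iff lookup_minus lookup_single when_def)
  qed
  then have vc: "vars_in (S - {j}) c" unfolding c_def by (intro vars_in_sum) auto
  have "c \<noteq> 0"
  proof
    assume "c = 0"
    then have "deg_lt j d F" using deg by simp
    then show False using m0 by (auto simp: deg_lt_def)
  qed
  moreover have "vars_in (- {j}) c" using vc by (rule vars_in_mono) auto
  ultimately have "top_term j d c F" using deg by (simp add: top_term_def)
  then show ?thesis using vc by (rule that)
qed

lemma top_term_unique:
  fixes F :: "'s::{finite,linorder} cpoly"
  assumes "top_term j d c F" "top_term j e b F"
  shows "d = e" "c = b"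
proof -
  have aux: "e \<le> d" if dc: "top_term j d c F" and eb: "top_term j e b F" for d e c b
  proof (rule ccontr)
    assume "\<not> e \<le> d"
    then have "deg_lt j e (F - c * xpow j d)" "deg_lt j e (c * xpow j d)"
      using dc deg_lt_free_times_xpow[of j c d]
      by (auto simp: top_term_def intro: deg_lt_mono)
    then have "deg_lt j e F" using deg_lt_add[of j e "F - c * xpow j d" "c * xpow j d"] by simp
    moreover have "deg_lt j e (F - b * xpow j e)" using eb by (simp add: top_term_def)
    ultimately have "deg_lt j e (F - (F - b * xpow j e))" by (rule deg_lt_minus)
    then show False using eb free_coeff_zero[of j b e] by (simp add: top_term_def)
  qed
  show "d = e" using aux[OF assms] aux[OF assms(2,1)] by simp
  have "deg_lt j d (F - b * xpow j d)" "deg_lt j d (F - c * xpow j d)"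
    using assms \<open>d = e\<close> by (simp_all add: top_term_def)
  then have "deg_lt j d ((F - b * xpow j d) - (F - c * xpow j d))" by (rule deg_lt_minus)
  then have "deg_lt j d ((c - b) * xpow j d)" by (simp add: algebra_simps)
  moreover have "vars_in (- {j}) (c - b)"
    using assms by (intro vars_in_minus) (auto simp: top_term_def)
  ultimately have "c - b = 0" by (intro free_coeff_zero)
  then show "c = b" by simp
qed

lemma top_term_deg_lt:
  assumes "top_term j d c F"
  shows "deg_lt j (Suc d) F"
proof -
  have "deg_lt j (Suc d) (F - c * xpow j d)" "deg_lt j (Suc d) (c * xpow j d)"
    using assms deg_lt_free_times_xpow[of j c d] by (auto simp: top_term_def intro: deg_lt_mono)
  then have "deg_lt j (Suc d) (F - c * xpow j d + c * xpow j d)" by (rule deg_lt_add)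
  then show ?thesis by simp
qed

lemma top_term_mult:
  fixes F :: "'s::{finite,linorder} cpoly"
  assumes "top_term j d c F" "top_term j e b G"
  shows "top_term j (d + e) (c * b) (F * G)"
proof -
  let ?f = "F - c * xpow j d" and ?g = "G - b * xpow j e"
  have "deg_lt j (Suc e) G" using assms(2) by (rule top_term_deg_lt)
  then have "deg_lt j (d + e) (?f * G)"
    using assms by (intro deg_lt_mult) (auto simp: top_term_def)
  moreover have "deg_lt j (e + d) (?g * (c * xpow j d))"
    using assms by (intro deg_lt_mult deg_lt_free_times_xpow) (auto simp: top_term_def)
  ultimately have "deg_lt j (d + e) (?f * G + ?g * (c * xpow j d))"
    by (intro deg_lt_add) (simp_all add: add.commute)
  moreover have "?f * G + ?g * (c * xpow j d) = F * G - (c * b) * xpow j (d + e)"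
    unfolding xpow_add by (simp add: algebra_simps)
  ultimately show ?thesis
    using assms by (auto simp: top_term_def intro: vars_in_mult)
qed

lemma top_term_0_iff:
  "top_term j 0 c F \<longleftrightarrow> c \<noteq> 0 \<and> vars_in (- {j}) c \<and> F = c"
  by (auto simp: top_term_def)

lemma deg_lt_exists:
  fixes F :: "'s::{finite,linorder} cpoly"
  obtains a where "deg_lt j a F"
proof (cases "F = 0")
  case False
  then obtain d c where "top_term j d c F" by (rule top_term_exists[OF _ vars_in_UNIV])
  then have "deg_lt j (Suc d) F" by (rule top_term_deg_lt)
  then show ?thesis by (rule that)
qed (use that in simp)

text \<open>Degrees in each variable add up under multiplication, so a variable missing from a non-zero
  product is missing from its factors. Factorizations of a polynomial in the variables \<open>S\<close>
  therefore stay in the variables \<open>S\<close>.\<close>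

lemma vars_in_factor:
  fixes F :: "'s::{finite,linorder} cpoly"
  assumes "vars_in S (F * G)" "F * G \<noteq> 0"
  shows "vars_in S F" "vars_in S G"
proof -
  have aux: "vars_in S F" if vars: "vars_in S (F * G)" and nz: "F * G \<noteq> 0" for F G :: "'s cpoly"
    unfolding vars_in_iff_forall[of S]
  proof (intro allI impI)
    fix j assume "j \<notin> S"
    then have "vars_in (- {j}) (F * G)" using vars by (simp add: vars_in_iff_forall[of S])
    then have 0: "top_term j 0 (F * G) (F * G)" using nz by (simp add: top_term_0_iff)
    have nzs: "F \<noteq> 0" "G \<noteq> 0" using nz by auto
    obtain d c where 1: "top_term j d c F" by (rule top_term_exists[OF nzs(1) vars_in_UNIV])
    obtain e b where 2: "top_term j e b G" by (rule top_term_exists[OF nzs(2) vars_in_UNIV])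
    have "d + e = 0" using top_term_unique(1)[OF top_term_mult[OF 1 2] 0] .
    then have "top_term j 0 c F" using 1 by simp
    then show "vars_in (- {j}) F" by (simp add: top_term_0_iff)
  qed
  show "vars_in S F" using aux assms by blast
  show "vars_in S G" using aux[of G F] assms by (simp add: mult.commute)
qed

section \<open>Units and irreducible factors\<close>

text \<open>The zero polynomial has no leading term; its degree is left unspecified.\<close>

definition var_degree :: "'s \<Rightarrow> 's cpoly \<Rightarrow> nat" where
  "var_degree j F = (THE d. \<exists>c. top_term j d c F)"

lemma var_degree_eq:
  fixes F :: "'s::{finite,linorder} cpoly"
  shows "top_term j d c F \<Longrightarrow> var_degree j F = d"
  unfolding var_degree_def using top_term_unique by blast

lemma var_degree_mult:
  fixes F :: "'s::{finite,linorder} cpoly"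
  assumes "F \<noteq> 0" "G \<noteq> 0"
  shows "var_degree j (F * G) = var_degree j F + var_degree j G"
proof -
  obtain d c where 1: "top_term j d c F" by (rule top_term_exists[OF assms(1) vars_in_UNIV])
  obtain e b where 2: "top_term j e b G" by (rule top_term_exists[OF assms(2) vars_in_UNIV])
  show ?thesis using var_degree_eq[OF 1] var_degree_eq[OF 2] var_degree_eq[OF top_term_mult[OF 1 2]] by simp
qed

lemma var_degree_0_iff:
  fixes F :: "'s::{finite,linorder} cpoly"
  assumes "F \<noteq> 0"
  shows "var_degree j F = 0 \<longleftrightarrow> vars_in (- {j}) F"
proof -
  obtain d c where 1: "top_term j d c F" by (rule top_term_exists[OF assms vars_in_UNIV])
  show ?thesis
  proof
    assume "var_degree j F = 0"
    then have "top_term j 0 c F" using 1 var_degree_eq by metis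
    then show "vars_in (- {j}) F" by (simp add: top_term_0_iff)
  next
    assume "vars_in (- {j}) F"
    then have "top_term j 0 F F" using assms by (simp add: top_term_0_iff)
    then show "var_degree j F = 0" by (rule var_degree_eq)
  qed
qed

text \<open>On non-zero polynomials this size is additive and zero exactly on constants, so factorization
  terminates.\<close>

definition degree_sum :: "'s::finite cpoly \<Rightarrow> nat" where
  "degree_sum F = (\<Sum>j\<in>UNIV. var_degree j F)"

lemma degree_sum_mult:
  fixes F :: "'s::{finite,linorder} cpoly"
  assumes "F \<noteq> 0" "G \<noteq> 0"
  shows "degree_sum (F * G) = degree_sum F + degree_sum G"
  using assms by (simp add: degree_sum_def var_degree_mult sum.distrib)

lemma degree_sum_0_iff:
  fixes F :: "'s::{finite,linorder} cpoly"
  assumes "F \<noteq> 0"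
  shows "degree_sum F = 0 \<longleftrightarrow> (\<exists>c. F = const_poly c)"
proof -
  have "degree_sum F = 0 \<longleftrightarrow> (\<forall>j. vars_in (- {j}) F)"
    using assms by (simp add: degree_sum_def var_degree_0_iff)
  also have "\<dots> \<longleftrightarrow> vars_in {} F" using vars_in_iff_forall[of "{}" F] by blast
  finally show ?thesis by (simp add: vars_in_empty_iff)
qed

lemma const_poly_mult: "const_poly a * const_poly b = const_poly (a * b)"
  by (simp add: const_poly_def mult_single)

lemma const_poly_1 [simp]: "const_poly 1 = 1"
  by (simp add: const_poly_def)

lemma const_poly_eq_0_iff [simp]: "const_poly c = 0 \<longleftrightarrow> c = 0"
  by (metis const_poly_def lookup_single_eq lookup_zero single_zero)

lemma is_unit_iff_degree_sum:
  fixes F :: "'s::{finite,linorder} cpoly"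
  shows "F dvd 1 \<longleftrightarrow> F \<noteq> 0 \<and> degree_sum F = 0"
proof
  assume "F dvd 1"
  then obtain G where G: "1 = F * G" by (auto elim: dvdE)
  then have "F \<noteq> 0" "G \<noteq> 0" by (metis mult_zero_left mult_zero_right zero_neq_one)+
  moreover have "degree_sum (1 :: 's cpoly) = 0"
    using degree_sum_0_iff[of "1 :: 's cpoly"] by (auto intro!: exI[of _ 1])
  ultimately show "F \<noteq> 0 \<and> degree_sum F = 0" using degree_sum_mult[of F G] unfolding G[symmetric] by simp
next
  assume F: "F \<noteq> 0 \<and> degree_sum F = 0"
  then obtain c where c: "F = const_poly c" using degree_sum_0_iff[of F] by auto
  then have "c \<noteq> 0" using F by simp
  then have "1 = F * const_poly (inverse c)" unfolding c by (simp add: const_poly_mult)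
  then show "F dvd 1" by (rule dvdI)
qed

lemma is_unit_iff_const:
  fixes F :: "'s::{finite,linorder} cpoly"
  shows "F dvd 1 \<longleftrightarrow> (\<exists>c. c \<noteq> 0 \<and> F = const_poly c)"
proof (cases "F = 0")
  case True
  then show ?thesis using is_unit_iff_degree_sum[of F] by auto
next
  case False
  then show ?thesis using is_unit_iff_degree_sum[of F] degree_sum_0_iff[of F] by auto
qed

lemma irreducible_factor_exists:
  fixes F :: "'s::{finite,linorder} cpoly"
  assumes "F \<noteq> 0" "\<not> F dvd 1"
  obtains f where "irreducible f" "f dvd F"
proof -
  have "\<exists>f. irreducible f \<and> f dvd F"
    using assms
  proof (induction "degree_sum F" arbitrary: F rule: less_induct)
    case less
    show ?case
    proof (cases "irreducible F")
      case False
      then have "\<exists>a b. F = a * b \<and> \<not> a dvd 1 \<and> \<not> b dvd 1"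
        using less.prems unfolding irreducible_def by blast
      then obtain a b where ab: "F = a * b" "\<not> a dvd 1" "\<not> b dvd 1" by blast
      then have "a \<noteq> 0" "b \<noteq> 0" using less.prems(1) by (metis mult_zero_left mult_zero_right)+
      then have "degree_sum a < degree_sum F"
        using ab(3) degree_sum_mult[of a b] is_unit_iff_degree_sum[of b] unfolding ab(1) by simp
      then show ?thesis using less.hyps[OF _ \<open>a \<noteq> 0\<close> ab(2)] dvd_mult2[of _ a b] unfolding ab(1) by blast
    next
      case True
      then show ?thesis using dvd_refl by blast
    qed
  qed
  then show ?thesis by (elim exE conjE) (rule that)
qed

lemma cpoly_factor_induct [consumes 1, case_names unit irreducible]:
  fixes F :: "'s::{finite,linorder} cpoly"
  assumes "F \<noteq> 0"
    and unit: "\<And>u. u dvd 1 \<Longrightarrow> P u"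
    and irr: "\<And>f G. irreducible f \<Longrightarrow> G \<noteq> 0 \<Longrightarrow> P G \<Longrightarrow> P (f * G)"
  shows "P F"
  using \<open>F \<noteq> 0\<close>
proof (induction "degree_sum F" arbitrary: F rule: less_induct)
  case less
  show ?case
  proof (cases "F dvd 1")
    case False
    obtain f where f: "irreducible f" "f dvd F"
      by (rule irreducible_factor_exists[OF less.prems False])
    then obtain G where G: "F = f * G" unfolding dvd_def by blast
    then have "G \<noteq> 0" "f \<noteq> 0" using less.prems by (metis mult_zero_left mult_zero_right)+
    then have "degree_sum G < degree_sum F"
      using f(1) degree_sum_mult[of f G] is_unit_iff_degree_sum[of f]
      unfolding G irreducible_def by auto
    then show ?thesis using less.hyps[of G] \<open>G \<noteq> 0\<close> irr[OF f(1), of G] unfolding G by blast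
  qed (rule unit)
qed

section \<open>Irreducible polynomials are prime\<close>

text \<open>Primality is relative to the polynomials in the variables \<open>S\<close>, since the induction
  on \<open>S\<close> knows nothing about the other variables yet.\<close>

definition prime_in :: "'s set \<Rightarrow> 's::{finite,linorder} cpoly \<Rightarrow> bool" where
  "prime_in S f \<longleftrightarrow>
     (\<forall>g h. vars_in S g \<longrightarrow> vars_in S h \<longrightarrow> f dvd g * h \<longrightarrow> f dvd g \<or> f dvd h)"

lemma vars_in_Int: "vars_in S F \<Longrightarrow> vars_in T F \<Longrightarrow> vars_in (S \<inter> T) F"
  by (auto simp: vars_in_def)

lemma vars_in_unit:
  fixes F :: "'s::{finite,linorder} cpoly"
  shows "F dvd 1 \<Longrightarrow> vars_in S F"
  by (auto simp: is_unit_iff_const)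

lemma top_term_less:
  fixes F :: "'s::{finite,linorder} cpoly"
  assumes "top_term j d c F" "deg_lt j a F"
  shows "d < a"
proof (rule ccontr)
  assume "\<not> d < a"
  then have "deg_lt j d F" using assms(2) by (auto intro: deg_lt_mono)
  moreover have "deg_lt j d (F - c * xpow j d)" using assms(1) by (simp add: top_term_def)
  ultimately have "deg_lt j d (F - (F - c * xpow j d))" by (rule deg_lt_minus)
  then show False using assms(1) free_coeff_zero[of j c d] by (simp add: top_term_def)
qed

text \<open>A prime stays prime after adjoining a variable: it divides the product of the leading
  coefficients of \<open>g\<close> and \<open>h\<close>, hence one of them, and that leading term can be removed without
  changing the claim.\<close>

lemma prime_in_insert:
  fixes f :: "'s::{finite,linorder} cpoly"
  assumes prime: "prime_in S f" and "f \<noteq> 0" "vars_in S f" "j \<notin> S"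
  shows "prime_in (insert j S) f"
  unfolding prime_in_def
proof (intro allI impI)
  fix g h :: "'s cpoly"
  assume gh: "vars_in (insert j S) g" "vars_in (insert j S) h" "f dvd g * h"
  have S: "insert j S - {j} = S" using \<open>j \<notin> S\<close> by auto
  have f_top: "top_term j 0 f f"
    using assms vars_in_mono[of S f "- {j}"] by (auto simp: top_term_0_iff)
  have rest: "vars_in (insert j S) (g - c * xpow j d)" if "vars_in (insert j S) g" "vars_in S c" for g c d
    using that by (intro vars_in_minus vars_in_mult vars_in_xpow) (auto intro: vars_in_mono)
  have "f dvd g \<or> f dvd h" if "deg_lt j a g" "deg_lt j b h" "vars_in (insert j S) g"
    "vars_in (insert j S) h" "f dvd g * h" for a b
    using that
  proof (induction "a + b" arbitrary: a b g h rule: less_induct)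
    case less
    show ?case
    proof (cases "g = 0 \<or> h = 0")
      case False
      then have nz: "g \<noteq> 0" "h \<noteq> 0" by auto
      obtain d c where g: "top_term j d c g" "vars_in S c"
        by (rule top_term_exists[OF nz(1) less.prems(3), of j, unfolded S])
      obtain e k where h: "top_term j e k h" "vars_in S k"
        by (rule top_term_exists[OF nz(2) less.prems(4), of j, unfolded S])
      obtain w where w: "g * h = f * w" using less.prems(5) unfolding dvd_def by blast
      then have "w \<noteq> 0" using nz by (metis mult_eq_0_iff)
      then obtain l v where "top_term j l v w" by (rule top_term_exists[OF _ vars_in_UNIV])
      then have "top_term j (0 + l) (f * v) (g * h)" using top_term_mult[OF f_top] w by simp
      then have "c * k = f * v" using top_term_unique(2)[OF top_term_mult[OF g(1) h(1)]] by blast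
      then have "f dvd c * k" by simp
      then have "f dvd c \<or> f dvd k" using prime g(2) h(2) by (simp add: prime_in_def)
      then show ?thesis
      proof
        assume "f dvd c"
        let ?g = "g - c * xpow j d"
        have "f dvd ?g * h"
          using less.prems(5) \<open>f dvd c\<close> by (simp add: left_diff_distrib dvd_diff dvd_mult2)
        then have "f dvd ?g \<or> f dvd h"
          using less.hyps[of d b ?g h] g less.prems top_term_less[OF g(1)] rest
          by (simp add: top_term_def)
        then show ?thesis using \<open>f dvd c\<close> by (metis diff_add_cancel dvd_add dvd_mult2)
      next
        assume "f dvd k"
        let ?h = "h - k * xpow j e"
        have "f dvd g * ?h"
          using less.prems(5) \<open>f dvd k\<close> by (simp add: right_diff_distrib dvd_diff dvd_mult2 dvd_mult)
        then have "f dvd g \<or> f dvd ?h"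
          using less.hyps[of a e g ?h] h less.prems top_term_less[OF h(1)] rest
          by (simp add: top_term_def)
        then show ?thesis using \<open>f dvd k\<close> by (metis diff_add_cancel dvd_add dvd_mult2)
      qed
    qed auto
  qed
  moreover obtain a where "deg_lt j a g" by (rule deg_lt_exists)
  moreover obtain b where "deg_lt j b h" by (rule deg_lt_exists)
  ultimately show "f dvd g \<or> f dvd h" using gh by blast
qed

text \<open>Gauss's lemma in the form used below: if \<open>c\<close> is a product of primes and \<open>c F = e q\<close>, each prime
  factor of \<open>c\<close> can be cancelled against \<open>e\<close> or \<open>q\<close>, and what remains is a factorization of \<open>F\<close>.\<close>

lemma split_common_factor:
  fixes c :: "'s::{finite,linorder} cpoly"
  assumes "c \<noteq> 0" "vars_in S c"
    and prime: "\<And>\<pi>. irreducible \<pi> \<Longrightarrow> vars_in S \<pi> \<Longrightarrow> prime_in T \<pi>"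
    and "vars_in T e" "vars_in T q" "c * F = e * q"
  shows "\<exists>a b e' q'. c = a * b \<and> e = a * e' \<and> q = b * q' \<and> F = e' * q'"
  using assms(1,2,4-)
proof (induction c arbitrary: e q rule: cpoly_factor_induct)
  case (unit u)
  then obtain w where w: "1 = u * w" unfolding dvd_def by blast
  have "F = (u * w) * F" unfolding w[symmetric] by simp
  also have "\<dots> = w * (u * F)" by (simp add: ac_simps)
  also have "\<dots> = e * (w * q)" using unit by (simp add: ac_simps)
  finally have "F = e * (w * q)" .
  moreover have "q = (u * w) * q" unfolding w[symmetric] by simp
  then have "q = u * (w * q)" by (simp add: ac_simps)
  moreover have "u = 1 * u" "e = 1 * e" by simp_all
  ultimately show ?case by blast
next
  case (irreducible f G)
  have fG: "vars_in S f" "vars_in S G" "f \<noteq> 0"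
    using irreducible vars_in_factor[of S f G] by (auto simp: irreducible_def)
  have cancel: "vars_in T x" if x: "vars_in T (f * x)" for x
    using x fG vars_in_factor(2)[of T f x] by (cases "x = 0") auto
  have "f * (G * F) = e * q" using irreducible.prems(4) by (simp add: ac_simps)
  then have "f dvd e * q" by (metis dvd_triv_left)
  then consider "f dvd e" | "f dvd q"
    using prime[OF irreducible(1) fG(1)] irreducible.prems(2,3) by (auto simp: prime_in_def)
  then show ?case
  proof cases
    case 1
    then obtain e1 where e1: "e = f * e1" unfolding dvd_def by blast
    have "f * (G * F) = f * (e1 * q)" using irreducible.prems e1 by (simp add: ac_simps)
    then have "G * F = e1 * q" using fG(3) by simp
    moreover have "vars_in T e1" using cancel irreducible.prems(2) e1 by simp
    ultimately obtain a b e' q' where 1: "G = a * b" "e1 = a * e'" "q = b * q'" "F = e' * q'"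
      using irreducible.IH[OF fG(2) _ irreducible.prems(3)] by blast
    then have "f * G = (f * a) * b" "e = (f * a) * e'" using e1 by (simp_all add: ac_simps)
    then show ?thesis using 1(3,4) by blast
  next
    case 2
    then obtain q1 where q1: "q = f * q1" unfolding dvd_def by blast
    have "f * (G * F) = f * (e * q1)" using irreducible.prems q1 by (simp add: ac_simps)
    then have "G * F = e * q1" using fG(3) by simp
    moreover have "vars_in T q1" using cancel irreducible.prems(3) q1 by simp
    ultimately obtain a b e' q' where 1: "G = a * b" "e = a * e'" "q1 = b * q'" "F = e' * q'"
      using irreducible.IH[OF fG(2) irreducible.prems(2)] by blast
    then have "f * G = a * (f * b)" "q = (f * b) * q'" using q1 by (simp_all add: ac_simps)
    then show ?thesis using 1(2,4) by blast
  qed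
qed

text \<open>Division with remainder in \<open>x\<^sub>j\<close> works over the fraction field of the other variables. Cleared of
  denominators it says that an element of least degree in \<open>x\<^sub>j\<close> divides every element of
  the ideal generated by \<open>f\<close> and \<open>g\<close> up to a non-zero factor free of \<open>x\<^sub>j\<close>.\<close>

lemma ideal_generator_up_to_coefficients:
  fixes f g :: "'s::{finite,linorder} cpoly"
  assumes I_def: "I = {u * f + v * g | u v. vars_in T u \<and> vars_in T v}"
    and "f \<noteq> 0" "vars_in T f" "vars_in T g" "j \<in> T"
  shows "\<exists>e\<in>I. e \<noteq> 0 \<and>
    (\<forall>h\<in>I. \<exists>c q. c \<noteq> 0 \<and> vars_in (T - {j}) c \<and> vars_in T q \<and> c * h = e * q)"
proof -
  have I_vars: "vars_in T h" if h: "h \<in> I" for h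
  proof -
    obtain u v where "h = u * f + v * g" "vars_in T u" "vars_in T v" using h unfolding I_def by blast
    then show ?thesis using assms by (auto intro: vars_in_add vars_in_mult)
  qed
  have I_comb: "a * h + b * k \<in> I"
    if hk: "h \<in> I" "k \<in> I" and ab: "vars_in T a" "vars_in T b" for a b h k
  proof -
    obtain u v u' v' where
      "h = u * f + v * g" "k = u' * f + v' * g" and V: "vars_in T u" "vars_in T v" "vars_in T u'" "vars_in T v'"
      using hk unfolding I_def by blast
    then have "a * h + b * k = (a * u + b * u') * f + (a * v + b * v') * g"
      by (simp add: algebra_simps)
    moreover have "vars_in T (a * u + b * u')" "vars_in T (a * v + b * v')"
      using V ab by (auto intro: vars_in_add vars_in_mult)
    ultimately show ?thesis unfolding I_def by blast
  qed
  have "f \<in> I" unfolding I_def by (intro CollectI exI[of _ 1] exI[of _ 0]) simp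
  define D where "D d \<longleftrightarrow> (\<exists>e c. e \<in> I \<and> top_term j d c e)" for d
  obtain d0 c1 where "top_term j d0 c1 f" by (rule top_term_exists[OF \<open>f \<noteq> 0\<close> vars_in_UNIV])
  then have "\<exists>d. D d" unfolding D_def using \<open>f \<in> I\<close> by blast
  then have "D (LEAST d. D d)" by (rule LeastI_ex)
  then obtain e c0' where e: "e \<in> I" "top_term j (LEAST d. D d) c0' e" unfolding D_def by blast
  define d where "d = (LEAST d. D d)"
  have d_min: "d \<le> k" if "h \<in> I" "top_term j k b h" for h k b
    unfolding d_def by (rule Least_le) (use that D_def in blast)
  have "e \<noteq> 0"
    using e(2) free_coeff_zero[of j c0'] by (auto simp: top_term_def)
  then obtain d1 c0 where c01: "top_term j d1 c0 e" "vars_in (T - {j}) c0"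
    by (rule top_term_exists[OF _ I_vars[OF e(1)]])
  then have c0: "top_term j d c0 e" "vars_in (T - {j}) c0"
    using top_term_unique(1)[OF e(2) c01(1)] by (simp_all add: d_def)
  have "\<exists>c q. c \<noteq> 0 \<and> vars_in (T - {j}) c \<and> vars_in T q \<and> c * h = e * q"
    if "h \<in> I" "deg_lt j a h" for h a
    using that
  proof (induction a arbitrary: h rule: less_induct)
    case (less a)
    show ?case
    proof (cases "h = 0")
      case True
      then show ?thesis by (intro exI[of _ 1] exI[of _ 0]) auto
    next
      case False
      obtain k b where h: "top_term j k b h" "vars_in (T - {j}) b"
        by (rule top_term_exists[OF False I_vars[OF less.prems(1)]])
      have "d \<le> k" using d_min h(1) less.prems(1) by blast
      have Tj: "vars_in T x" if "vars_in (T - {j}) x" for x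
        using that by (rule vars_in_mono) auto
      let ?m = "b * xpow j (k - d)"
      \<comment> \<open>One step of pseudo-division: the leading terms of \<open>c0 h\<close> and \<open>b x\<^sub>j\<^sup>k\<^sup>-\<^sup>d e\<close> agree.\<close>
      let ?h = "c0 * h + (- ?m) * e"
      have x: "xpow j k = xpow j (k - d) * xpow j d"
        using \<open>d \<le> k\<close> xpow_add[of j "k - d" d] by simp
      have "?h = (h - b * xpow j k) * c0 - (e - c0 * xpow j d) * ?m"
        unfolding x by (simp add: algebra_simps)
      moreover have "deg_lt j (k + 0) ((h - b * xpow j k) * c0)"
        using h c0 by (intro deg_lt_mult deg_lt_free) (auto simp: top_term_def)
      moreover have "deg_lt j (d + (k - d)) ((e - c0 * xpow j d) * ?m)"
        using h c0 by (intro deg_lt_mult deg_lt_free_times_xpow) (auto simp: top_term_def)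
      ultimately have "deg_lt j k ?h" using \<open>d \<le> k\<close> by (auto intro: deg_lt_minus)
      moreover have vm: "vars_in T ?m" by (rule vars_in_mult[OF Tj[OF h(2)] vars_in_xpow[OF assms(5)]])
      then have "?h \<in> I" using less.prems(1) e(1) Tj c0(2) I_comb[of h e c0 "- ?m"] by simp
      moreover have "k < a" using top_term_less[OF h(1)] less.prems(2) .
      ultimately obtain c q where cq: "c \<noteq> 0" "vars_in (T - {j}) c" "vars_in T q" "c * ?h = e * q"
        using less.IH by blast
      have "(c * c0) * h = e * (q + c * ?m)" using cq(4) by (simp add: algebra_simps)
      moreover have "c * c0 \<noteq> 0" using cq(1) c0(1) by (simp add: top_term_def)
      moreover have "vars_in (T - {j}) (c * c0)" by (rule vars_in_mult[OF cq(2) c0(2)])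
      moreover have "vars_in T (q + c * ?m)" by (rule vars_in_add[OF cq(3) vars_in_mult[OF Tj[OF cq(2)] vm]])
      ultimately show ?thesis by blast
    qed
  qed
  then have "\<exists>c q. c \<noteq> 0 \<and> vars_in (T - {j}) c \<and> vars_in T q \<and> c * h = e * q"
    if "h \<in> I" for h
    using deg_lt_exists[of j h] that by metis
  then show ?thesis using e(1) \<open>e \<noteq> 0\<close> by blast
qed

text \<open>If the generator \<open>e\<close> above involved \<open>x\<^sub>j\<close>, cancelling the coefficients from \<open>c f = e q\<close> would leave
  a factor of \<open>f\<close> that involves \<open>x\<^sub>j\<close>, and by irreducibility it would be \<open>f\<close> up to a unit. The same
  cancellation for \<open>g\<close> would then make \<open>f\<close> divide \<open>g\<close>. So \<open>e\<close> is free of \<open>x\<^sub>j\<close>.\<close>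

lemma elimination_step:
  fixes f g :: "'s::{finite,linorder} cpoly"
  assumes prime: "\<And>\<pi>. irreducible \<pi> \<Longrightarrow> vars_in (T - {j}) \<pi> \<Longrightarrow> prime_in T \<pi>"
    and f: "irreducible f" "vars_in T f" "\<not> vars_in (- {j}) f"
    and g: "vars_in T g" "\<not> f dvd g"
  shows "\<exists>u v. vars_in T u \<and> vars_in T v \<and> u * f + v * g \<noteq> 0 \<and> vars_in (T - {j}) (u * f + v * g)"
proof -
  have "f \<noteq> 0" using f by (auto simp: irreducible_def)
  have "j \<in> T"
  proof (rule ccontr)
    assume "j \<notin> T"
    then have "T \<subseteq> - {j}" by auto
    then show False using f(2,3) vars_in_mono[of T f] by blast
  qed
  define I where "I = {u * f + v * g | u v. vars_in T u \<and> vars_in T v}"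
  obtain e where e: "e \<in> I" "e \<noteq> 0"
    and gen: "\<forall>h\<in>I. \<exists>c q. c \<noteq> 0 \<and> vars_in (T - {j}) c \<and> vars_in T q \<and> c * h = e * q"
    using ideal_generator_up_to_coefficients[OF I_def \<open>f \<noteq> 0\<close> f(2) g(1) \<open>j \<in> T\<close>] by blast
  have "f \<in> I" unfolding I_def by (intro CollectI exI[of _ 1] exI[of _ 0]) simp
  have "g \<in> I" unfolding I_def by (intro CollectI exI[of _ 0] exI[of _ 1]) simp
  obtain u v where uv: "e = u * f + v * g" "vars_in T u" "vars_in T v"
    using e(1) unfolding I_def by blast
  then have e_vars: "vars_in T e" using f(2) g(1) by (auto intro: vars_in_add vars_in_mult)
  show ?thesis
  proof (cases "vars_in (- {j}) e")
    case True
    then have "vars_in (T - {j}) e" using vars_in_Int[OF e_vars] by (simp add: Diff_eq)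
    then show ?thesis using e(2) uv by blast
  next
    case False
    obtain c q where c: "c \<noteq> 0" "vars_in (T - {j}) c" "vars_in T q" "c * f = e * q"
      using gen \<open>f \<in> I\<close> by blast
    obtain a b e' q' where 1: "c = a * b" "e = a * e'" "f = e' * q'"
      using split_common_factor[OF c(1,2) _ e_vars c(3,4)] prime by metis
    have free: "vars_in (- {j}) x" if xy: "vars_in (T - {j}) (x * y)" "x * y \<noteq> 0" for x y
      using vars_in_factor(1)[OF xy] by (rule vars_in_mono) auto
    have a_free: "vars_in (- {j}) a" using free[of a b] c(1,2) 1(1) by simp
    then have e'_nonfree: "\<not> vars_in (- {j}) e'" using False 1(2) vars_in_mult[OF a_free, of e'] by auto
    then have "\<not> e' dvd 1" using vars_in_unit[of e'] by auto
    then have q'_unit: "q' dvd 1" using f(1) 1(3) unfolding irreducible_def by blast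
    have vT: "vars_in T a" "vars_in T e'"
      using vars_in_factor[of T a e'] e_vars 1(2) e(2) by auto
    obtain c2 q2 where c2: "c2 \<noteq> 0" "vars_in (T - {j}) c2" "vars_in T q2" "c2 * g = e * q2"
      using gen \<open>g \<in> I\<close> by blast
    then have "c2 * g = e' * (a * q2)" using 1(2) by (simp add: ac_simps)
    then obtain a2 b2 e2 q3 where 2: "c2 = a2 * b2" "e' = a2 * e2" "g = e2 * q3"
      using split_common_factor[OF c2(1,2) _ vT(2) vars_in_mult[OF vT(1) c2(3)]] prime by metis
    have "vars_in (- {j}) a2" using free[of a2 b2] c2(1,2) 2(1) by simp
    then have e2: "\<not> e2 dvd 1"
      using e'_nonfree 2(2) vars_in_mult[of "- {j}" a2 e2] vars_in_unit[of e2 "- {j}"] by auto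
    have "f = a2 * (e2 * q')" using 1(3) 2(2) by (simp add: ac_simps)
    then have "a2 dvd 1 \<or> e2 * q' dvd 1" using f(1) unfolding irreducible_def by blast
    then have "a2 dvd 1" using e2 dvd_mult_left[of e2 q' 1] by auto
    then obtain w where w: "1 = a2 * w" unfolding dvd_def by blast
    obtain y where y: "1 = q' * y" using q'_unit unfolding dvd_def by blast
    have "e2 = (a2 * w) * e2 * (q' * y)" unfolding w[symmetric] y[symmetric] by simp
    also have "\<dots> = (a2 * (e2 * q')) * (w * y)" by (simp add: ac_simps)
    also have "\<dots> = f * (w * y)" unfolding \<open>f = a2 * (e2 * q')\<close> ..
    finally have "f dvd e2" by (rule dvdI)
    then have "f dvd g" unfolding 2(3) by (rule dvd_mult2)
    then show ?thesis using g(2) by blast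
  qed
qed

text \<open>Induction on the variables. If \<open>f\<close> involves the new variable \<open>x\<^sub>j\<close> and divides \<open>g h\<close> but not \<open>g\<close>,
  then \<open>f\<close> divides \<open>e h\<close> for some non-zero combination \<open>e\<close> of \<open>f\<close> and \<open>g\<close> free of \<open>x\<^sub>j\<close>; the factor \<open>e\<close> cancels,
  because none of its prime factors can divide \<open>f\<close>.\<close>

lemma irreducible_imp_prime_in:
  fixes f :: "'s::{finite,linorder} cpoly"
  assumes "finite S" "irreducible f" "vars_in S f"
  shows "prime_in S f"
  using assms
proof (induction S arbitrary: f rule: finite_induct)
  case empty
  then obtain c where "f = const_poly c" by (auto simp: vars_in_empty_iff)
  then have "f = 0 \<or> f dvd 1" using is_unit_iff_const[of f] by auto
  then show ?case using empty(1) unfolding irreducible_def by blast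
next
  case (insert j S)
  have S: "insert j S - {j} = S" using insert.hyps by auto
  have prime: "prime_in (insert j S) \<pi>" if "irreducible \<pi>" "vars_in S \<pi>" for \<pi>
    using prime_in_insert[OF insert.IH[OF that] _ that(2) insert.hyps(2)] that(1)
    unfolding irreducible_def by blast
  show ?case
  proof (cases "vars_in (- {j}) f")
    case True
    then have "vars_in (insert j S \<inter> - {j}) f" by (rule vars_in_Int[OF insert.prems(2)])
    then have "vars_in S f" by (rule vars_in_mono) auto
    then show ?thesis by (rule prime[OF insert.prems(1)])
  next
    case False
    show ?thesis
      unfolding prime_in_def
    proof (intro allI impI)
      fix g h assume gh: "vars_in (insert j S) g" "vars_in (insert j S) h" "f dvd g * h"
      show "f dvd g \<or> f dvd h"
      proof (rule disjCI, rule ccontr)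
        assume nh: "\<not> f dvd h" and ng: "\<not> f dvd g"
        obtain u v where uv: "vars_in (insert j S) u" "vars_in (insert j S) v"
          "u * f + v * g \<noteq> 0" "vars_in S (u * f + v * g)"
          using elimination_step[of "insert j S" j f g] prime insert.prems False gh(1) ng unfolding S by blast
        obtain w where w: "g * h = f * w" using gh(3) unfolding dvd_def by blast
        have "f \<noteq> 0" using insert.prems(1) unfolding irreducible_def by blast
        have "(u * f + v * g) * h = f * (u * h + v * w)" using w by (simp add: algebra_simps)
        moreover have "vars_in (insert j S) w"
          using vars_in_factor(2)[of "insert j S" f w] vars_in_mult[OF gh(1,2)] \<open>f \<noteq> 0\<close>
          unfolding w by (cases "w = 0") auto
        then have "vars_in (insert j S) (u * h + v * w)"
          using uv gh by (auto intro: vars_in_add vars_in_mult)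
        ultimately obtain a b e' q' where 1: "u * f + v * g = a * b" "f = a * e'" "h = e' * q'"
          using split_common_factor[OF uv(3,4) _ insert.prems(2)] prime by metis
        have "vars_in S a" using vars_in_factor(1)[of S a b] uv(3,4) 1(1) by simp
        then have a_free: "vars_in (- {j}) a" by (rule vars_in_mono) (use insert.hyps in auto)
        have "\<not> e' dvd 1"
          using False 1(2) vars_in_mult[OF a_free, of e'] vars_in_unit[of e' "- {j}"] by auto
        then have "a dvd 1" using insert.prems(1) 1(2) unfolding irreducible_def by blast
        then obtain w' where w': "1 = a * w'" unfolding dvd_def by blast
        have "e' = (a * w') * e'" unfolding w'[symmetric] by simp
        then have "e' = f * w'" using 1(2) by (simp add: ac_simps)
        then have "h = f * (w' * q')" using 1(3) by (simp add: ac_simps)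
        then show False using nh by simp
      qed
    qed
  qed
qed

theorem irreducible_imp_prime:
  fixes f :: "'s::{finite,linorder} cpoly"
  assumes "irreducible f" "f dvd g * h"
  shows "f dvd g \<or> f dvd h"
  using irreducible_imp_prime_in[OF finite assms(1) vars_in_UNIV] assms(2)
  unfolding prime_in_def by simp

theorem elimination:
  fixes f g :: "'s::{finite,linorder} cpoly"
  assumes "irreducible f" "\<not> vars_in (- {j}) f" "\<not> f dvd g"
  shows "\<exists>u v. u * f + v * g \<noteq> 0 \<and> vars_in (- {j}) (u * f + v * g)"
proof -
  have "prime_in UNIV \<pi>" if "irreducible \<pi>" for \<pi> :: "'s cpoly"
    using irreducible_imp_prime_in[OF finite that vars_in_UNIV] .
  then show ?thesis
    using elimination_step[of UNIV j f g] assms by (simp add: Compl_eq_Diff_UNIV)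
qed

section \<open>The vanishing ideal of a hypersurface\<close>

lemma poly_eval_cong_vars:
  assumes "vars_in S F" "\<And>i. i \<in> S \<Longrightarrow> p $ i = q $ i"
  shows "poly_eval F p = poly_eval F q"
  unfolding poly_eval_def
proof (intro sum.cong refl arg_cong2[where f = "(*)"] prod.cong)
  fix m i assume "m \<in> mkeys F"
  then have "mkeys m \<subseteq> S" using assms(1) by (simp add: vars_in_def)
  then have "lk m i = 0 \<or> i \<in> S" by (metis not_in_keys_iff_lookup_eq_zero subsetD)
  then show "(p $ i) ^ lk m i = (q $ i) ^ lk m i" using assms(2) by auto
qed

lemma poly_eval_free_upd:
  "vars_in (- {j}) F \<Longrightarrow> poly_eval F (point_upd p j t) = poly_eval F p"
  by (rule poly_eval_cong_vars) auto

lemma mono_eval_upd: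
  "mono_eval m (point_upd q j t) = t ^ lk m j * (\<Prod>i\<in>UNIV - {j}. (q $ i) ^ lk m i)"
  unfolding mono_eval_def by (subst prod.remove[of _ j]) auto

text \<open>On a line parallel to the \<open>j\<close>-th axis a polynomial becomes one in a single variable, to which the fundamental
  theorem of algebra applies.\<close>

lemma slice_poly_deg_lt:
  assumes "deg_lt j d F"
  shows "\<exists>P. (\<forall>k\<ge>d. Polynomial.coeff P k = 0) \<and> (\<forall>t. poly P t = poly_eval F (point_upd q j t))"
proof -
  define C where "C m = (\<Prod>i\<in>UNIV - {j}. (q $ i) ^ lk m i)" for m
  define P where "P = (\<Sum>m\<in>mkeys F. Polynomial.monom (lk F m * C m) (lk m j))"
  have "Polynomial.coeff P k = 0" if k: "k \<ge> d" for k
    unfolding P_def coeff_sum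
  proof (rule sum.neutral, rule ballI)
    fix m assume "m \<in> mkeys F"
    then have "lk m j < k" using assms k by (auto simp: deg_lt_def)
    then show "Polynomial.coeff (Polynomial.monom (lk F m * C m) (lk m j)) k = 0" by simp
  qed
  moreover have "poly P t = poly_eval F (point_upd q j t)" for t
    unfolding P_def poly_sum poly_eval_superset[OF finite_keys order_refl]
    by (rule sum.cong) (simp_all add: poly_monom mono_eval_upd C_def)
  ultimately show ?thesis by blast
qed

lemma slice_poly_top_term:
  assumes "top_term j d c F" "poly_eval c q \<noteq> 0"
  shows "\<exists>P. Polynomial.degree P = d \<and> P \<noteq> 0 \<and> (\<forall>t. poly P t = poly_eval F (point_upd q j t))"
proof -
  have "deg_lt j d (F - c * xpow j d)" using assms(1) by (simp add: top_term_def)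
  then obtain R where R: "\<forall>k\<ge>d. Polynomial.coeff R k = 0"
    "\<forall>t. poly R t = poly_eval (F - c * xpow j d) (point_upd q j t)"
    using slice_poly_deg_lt by blast
  have c: "poly_eval c (point_upd q j t) = poly_eval c q" for t
    using assms(1) by (intro poly_eval_free_upd) (simp add: top_term_def)
  define P where "P = Polynomial.monom (poly_eval c q) d + R"
  have top: "Polynomial.coeff P d = poly_eval c q" using R(1) by (simp add: P_def)
  have "Polynomial.degree P \<le> d" by (rule degree_le) (use R(1) in \<open>simp add: P_def\<close>)
  moreover have "d \<le> Polynomial.degree P" by (rule le_degree) (use top assms(2) in simp)
  ultimately have "Polynomial.degree P = d" by simp
  moreover have "P \<noteq> 0" using top assms(2) by auto
  moreover have "poly P t = poly_eval F (point_upd q j t)" for t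
    using R(2) by (simp add: P_def poly_monom c)
  ultimately show ?thesis by blast
qed

text \<open>By induction on the variables there is a point where the leading coefficient in \<open>x\<^sub>j\<close> does not vanish;
  on the line through it \<open>F\<close> is a non-zero polynomial in one variable.\<close>

lemma nonzero_imp_nonvanishing:
  fixes F :: "'s::{finite,linorder} cpoly"
  assumes "F \<noteq> 0"
  shows "\<exists>q. poly_eval F q \<noteq> 0"
proof -
  have "\<exists>q. poly_eval F q \<noteq> 0" if "finite S" "vars_in S F" "F \<noteq> 0" for S and F :: "'s cpoly"
    using that
  proof (induction S arbitrary: F rule: finite_induct)
    case empty
    then obtain c where "F = const_poly c" unfolding vars_in_empty_iff by blast
    then show ?case using empty by simp
  next
    case (insert j S)
    obtain d c where c: "top_term j d c F" "vars_in (insert j S - {j}) c"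
      by (rule top_term_exists[OF insert.prems(2,1)])
    have "vars_in S c" using c(2) by (rule vars_in_mono) auto
    then obtain q where "poly_eval c q \<noteq> 0"
      using insert.IH[of c] c(1) by (auto simp: top_term_def)
    then obtain P where P: "Polynomial.degree P = d" "P \<noteq> 0"
      "\<forall>t. poly P t = poly_eval F (point_upd q j t)"
      using slice_poly_top_term[OF c(1)] by blast
    have "\<exists>t. poly P t \<noteq> 0" using P(2) by (metis poly_0 poly_eq_poly_eq_iff ext)
    then show ?case using P(3) by metis
  qed
  then show ?thesis using assms finite vars_in_UNIV by blast
qed

lemma nonconstant_imp_variable:
  fixes f :: "'s::{finite,linorder} cpoly"
  assumes "\<forall>c. f \<noteq> const_poly c"
  obtains j where "\<not> vars_in (- {j}) f"
proof -
  have "\<not> vars_in {} f" using assms by (simp add: vars_in_empty_iff)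
  then have "\<exists>j. \<not> vars_in (- {j}) f" by (simp add: vars_in_iff_forall[of "{}"])
  then show ?thesis using that by (elim exE)
qed

lemma irreducible_nonconstant:
  fixes f :: "'s::{finite,linorder} cpoly"
  assumes "irreducible f"
  shows "f \<noteq> const_poly c"
proof
  assume "f = const_poly c"
  then have "f = 0 \<or> f dvd 1" using is_unit_iff_const[of f] by auto
  then show False using assms unfolding irreducible_def by blast
qed

text \<open>The Nullstellensatz for an irreducible hypersurface. Otherwise some non-zero \<open>u f + v G\<close> is free of
  a variable \<open>x\<^sub>j\<close> that occurs in \<open>f\<close>. Over a value \<open>q\<close> of the other variables where neither this polynomial nor the
  leading coefficient of \<open>f\<close> vanishes, \<open>f\<close> still has a zero by the fundamental theorem of
  algebra, and there \<open>u f + v G\<close> vanishes after all.\<close>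

theorem irreducible_dvd_if_vanishing:
  fixes f G :: "'s::{finite,linorder} cpoly"
  assumes "irreducible f" and vanish: "\<And>x. poly_eval f x = 0 \<Longrightarrow> poly_eval G x = 0"
  shows "f dvd G"
proof (rule ccontr)
  assume "\<not> f dvd G"
  obtain j where j: "\<not> vars_in (- {j}) f"
    by (rule nonconstant_imp_variable) (use irreducible_nonconstant[OF assms(1)] in blast)
  obtain u v where uv: "u * f + v * G \<noteq> 0" "vars_in (- {j}) (u * f + v * G)"
    using elimination[OF assms(1) j \<open>\<not> f dvd G\<close>] by blast
  have "f \<noteq> 0" using assms(1) unfolding irreducible_def by blast
  then obtain d c where c: "top_term j d c f" by (rule top_term_exists[OF _ vars_in_UNIV])
  have "d \<noteq> 0"
  proof
    assume "d = 0"
    then show False using c j by (simp add: top_term_0_iff)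
  qed
  have "(u * f + v * G) * c \<noteq> 0" using uv(1) c by (simp add: top_term_def)
  then obtain q where "poly_eval ((u * f + v * G) * c) q \<noteq> 0"
    using nonzero_imp_nonvanishing by blast
  then have q: "poly_eval (u * f + v * G) q \<noteq> 0" "poly_eval c q \<noteq> 0"
    unfolding poly_eval_mult by simp_all
  obtain P where P: "Polynomial.degree P = d" "P \<noteq> 0"
    "\<forall>t. poly P t = poly_eval f (point_upd q j t)"
    using slice_poly_top_term[OF c q(2)] by blast
  obtain t where "poly P t = 0"
    using fundamental_theorem_of_algebra[of P] P(1) \<open>d \<noteq> 0\<close> constant_degree[of P] by auto
  then have f0: "poly_eval f (point_upd q j t) = 0" using P(3) by simp
  have "poly_eval (u * f + v * G) q = poly_eval (u * f + v * G) (point_upd q j t)"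
    using poly_eval_free_upd[OF uv(2)] by simp
  also have "\<dots> = 0" using f0 vanish[OF f0] by simp
  finally show False using q(1) by simp
qed

theorem squarefree_dvd_if_vanishing:
  fixes F G :: "'s::{finite,linorder} cpoly"
  assumes "squarefree F" "F \<noteq> 0" "\<And>x. poly_eval F x = 0 \<Longrightarrow> poly_eval G x = 0"
  shows "F dvd G"
  using assms(2,1,3)
proof (induction F rule: cpoly_factor_induct)
  case (unit u)
  then show ?case using dvd_trans one_dvd by blast
next
  case (irreducible f H)
  have "squarefree H"
    unfolding squarefree_def
  proof (intro allI impI)
    fix x assume "x\<^sup>2 dvd H"
    then have "x\<^sup>2 dvd f * H" by (rule dvd_mult)
    then show "x dvd 1" using irreducible.prems(1) unfolding squarefree_def by blast
  qed
  moreover have "poly_eval G x = 0" if "poly_eval H x = 0" for x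
    using irreducible.prems(2)[of x] that by simp
  ultimately have "H dvd G" by (rule irreducible.IH)
  then obtain K where K: "G = H * K" unfolding dvd_def by blast
  have "f dvd G"
    by (rule irreducible_dvd_if_vanishing[OF irreducible(1)]) (use irreducible.prems(2) in simp)
  then have "f dvd H \<or> f dvd K" using irreducible_imp_prime[OF irreducible(1)] K by simp
  moreover have "\<not> f dvd H"
  proof
    assume "f dvd H"
    then have "f\<^sup>2 dvd f * H" by (simp add: power2_eq_square mult_dvd_mono)
    then have "f dvd 1" using irreducible.prems(1) unfolding squarefree_def by blast
    then show False using irreducible(1) unfolding irreducible_def by blast
  qed
  ultimately have "f dvd K" by blast
  then have "H * f dvd H * K" by (intro mult_dvd_mono dvd_refl)
  then show ?case using K by (simp add: mult.commute)
qed

section \<open>Partial derivatives and the tangent space\<close>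

lemma poly_eval_partial_deriv:
  "poly_eval (partial_deriv i F) p =
    (\<Sum>m\<in>mkeys F. of_nat (lk m i) * lk F m * mono_eval (m - mterm i 1) p)"
  unfolding partial_deriv_def poly_eval_sum by simp

lemma poly_eval_altdef: "poly_eval F p = (\<Sum>m\<in>mkeys F. lk F m * mono_eval m p)"
  by (rule poly_eval_superset) auto

text \<open>Identifying the formal derivative with the analytic one gives the product rule, and
  the derivative of a restriction, from uniqueness of derivatives. Only values of derivatives at points
  are needed.\<close>

lemma partial_deriv_has_derivative:
  "((\<lambda>t. poly_eval F (point_upd p i t)) has_field_derivative poly_eval (partial_deriv i F) p) (at (p $ i))"
proof -
  define C where "C m = (\<Prod>k\<in>UNIV - {i}. (p $ k) ^ lk m k)" for m
  have C: "mono_eval (m - mterm i 1) p = (p $ i) ^ (lk m i - 1) * C m" for m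
  proof -
    have "mono_eval (m - mterm i 1) p = mono_eval (m - mterm i 1) (point_upd p i (p $ i))" by simp
    also have "\<dots> = (p $ i) ^ (lk m i - 1) * C m"
      unfolding mono_eval_upd C_def
      by (intro arg_cong2[where f = "(*)"] prod.cong) (auto simp: lookup_minus lookup_single when_def)
    finally show ?thesis .
  qed
  have "((\<lambda>t. \<Sum>m\<in>mkeys F. lk F m * (t ^ lk m i * C m)) has_field_derivative
      (\<Sum>m\<in>mkeys F. of_nat (lk m i) * lk F m * ((p $ i) ^ (lk m i - 1) * C m))) (at (p $ i))"
    by (intro DERIV_sum) (auto intro!: derivative_eq_intros)
  then show ?thesis
    unfolding poly_eval_partial_deriv C poly_eval_altdef[of F] mono_eval_upd C_def .
qed

lemma partial_deriv_eval_cong: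
  assumes "\<And>t. poly_eval F (point_upd p i t) = poly_eval G (point_upd p i t)"
  shows "poly_eval (partial_deriv i F) p = poly_eval (partial_deriv i G) p"
  using DERIV_unique[OF partial_deriv_has_derivative[of F p i]] partial_deriv_has_derivative[of G p i]
  by (simp add: assms)

lemma partial_deriv_eval_mult:
  "poly_eval (partial_deriv i (F * G)) p =
    poly_eval (partial_deriv i F) p * poly_eval G p + poly_eval F p * poly_eval (partial_deriv i G) p"
proof -
  have "((\<lambda>t. poly_eval (F * G) (point_upd p i t)) has_field_derivative
    poly_eval (partial_deriv i F) p * poly_eval G (point_upd p i (p $ i))
      + poly_eval (partial_deriv i G) p * poly_eval F (point_upd p i (p $ i))) (at (p $ i))"
    unfolding poly_eval_mult by (intro DERIV_mult partial_deriv_has_derivative)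
  from DERIV_unique[OF partial_deriv_has_derivative this] show ?thesis by (simp add: mult.commute)
qed

text \<open>For a multiple \<open>G = F H\<close> the product rule gives \<open>\<partial>G(p) = \<partial>F(p) H(p)\<close>, as \<open>F(p) = 0\<close>. So \<open>F\<close> alone
  determines the tangent space.\<close>

theorem tangent_space_hypersurface:
  fixes F :: "'s::{finite,linorder} cpoly"
  assumes "squarefree F" "F \<noteq> 0" "poly_eval F p = 0"
  shows "tangent_space (zero_set {F}) p = {v. (\<Sum>i\<in>UNIV. poly_eval (partial_deriv i F) p * v $ i) = 0}"
proof (intro equalityI subsetI CollectI)
  fix v assume "v \<in> tangent_space (zero_set {F}) p"
  moreover have "F \<in> vanishing_ideal (zero_set {F})"
    by (simp add: vanishing_ideal_def zero_set_def)
  ultimately show "(\<Sum>i\<in>UNIV. poly_eval (partial_deriv i F) p * v $ i) = 0"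
    unfolding tangent_space_def by blast
next
  fix v assume v: "v \<in> {v. (\<Sum>i\<in>UNIV. poly_eval (partial_deriv i F) p * v $ i) = 0}"
  show "v \<in> tangent_space (zero_set {F}) p"
    unfolding tangent_space_def
  proof (intro CollectI ballI)
    fix G assume "G \<in> vanishing_ideal (zero_set {F})"
    then have "poly_eval G x = 0" if "poly_eval F x = 0" for x
      using that by (simp add: vanishing_ideal_def zero_set_def)
    then have "F dvd G" by (rule squarefree_dvd_if_vanishing[OF assms(1,2)])
    then obtain H where G: "G = F * H" unfolding dvd_def by blast
    have "(\<Sum>i\<in>UNIV. poly_eval (partial_deriv i G) p * v $ i)
        = poly_eval H p * (\<Sum>i\<in>UNIV. poly_eval (partial_deriv i F) p * v $ i)"
      unfolding G partial_deriv_eval_mult assms(3) sum_distrib_left by (simp add: ac_simps)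
    then show "(\<Sum>i\<in>UNIV. poly_eval (partial_deriv i G) p * v $ i) = 0" using v by simp
  qed
qed

lemma dim_hyperplane:
  fixes g :: "'s::finite \<Rightarrow> complex"
  assumes "g j \<noteq> 0"
  shows "vec.dim {v :: complex ^ 's. (\<Sum>i\<in>UNIV. g i * v $ i) = 0} = CARD('s) - 1"
proof -
  define H where "H = {v :: complex ^ 's. (\<Sum>i\<in>UNIV. g i * v $ i) = 0}"
  have sub: "vec.subspace H"
    unfolding H_def vec.subspace_def
    by (auto simp: distrib_left sum.distrib mult.left_commute simp flip: sum_distrib_left)
  have g_axis: "(\<Sum>i\<in>UNIV. g i * axis j (1::complex) $ i) = g j"
    by (simp add: axis_def if_distrib cong: if_cong)
  then have "axis j 1 \<notin> H" using assms unfolding H_def by simp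
  moreover have "vec.span H = H" using sub by (rule vec.span_eq_iff[THEN iffD2])
  ultimately have notin: "axis j 1 \<notin> vec.span H" by (simp only: not_False_eq_True)
  have "v \<in> vec.span (insert (axis j 1) H)" for v :: "complex ^ 's"
  proof -
    define c where "c = (\<Sum>i\<in>UNIV. g i * v $ i) / g j"
    have "(\<Sum>i\<in>UNIV. g i * (v - c *s axis j 1) $ i)
        = (\<Sum>i\<in>UNIV. g i * v $ i) - c * (\<Sum>i\<in>UNIV. g i * axis j (1::complex) $ i)"
      by (simp add: right_diff_distrib sum_subtractf sum_distrib_left ac_simps)
    also have "\<dots> = 0" unfolding g_axis using assms by (simp add: c_def)
    finally have "v - c *s axis j 1 \<in> H" by (simp add: H_def)
    then have "(v - c *s axis j 1) + c *s axis j 1 \<in> vec.span (insert (axis j 1) H)"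
      by (intro vec.span_add vec.span_scale vec.span_base) auto
    then show ?thesis by simp
  qed
  then have "vec.span (insert (axis j 1) H) = UNIV" by blast
  then have "vec.dim (insert (axis j 1) H) = CARD('s)"
    by (metis vec.dim_span vec_dim_card)
  then show ?thesis using notin by (simp add: vec.dim_insert H_def)
qed

section \<open>Upper bound for the dimension\<close>

text \<open>The vanishing ideal of \<open>Z\<close> is prime or the whole ring: the part of irreducibility on
  which the dimension bound rests.\<close>

definition prime_locus :: "(complex ^ 's::finite) set \<Rightarrow> bool" where
  "prime_locus Z \<longleftrightarrow> (\<forall>G H. (\<forall>z\<in>Z. poly_eval (G * H) z = 0) \<longrightarrow>
     (\<forall>z\<in>Z. poly_eval G z = 0) \<or> (\<forall>z\<in>Z. poly_eval H z = 0))"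

lemma alg_irreducible_imp_prime_locus:
  assumes "alg_irreducible Z"
  shows "prime_locus Z"
  unfolding prime_locus_def
proof (intro allI impI)
  fix G H assume GH: "\<forall>z\<in>Z. poly_eval (G * H) z = 0"
  obtain S where S: "Z = zero_set S"
    using assms unfolding alg_irreducible_def alg_closed_set_def by blast
  let ?Z1 = "zero_set (insert G S)" and ?Z2 = "zero_set (insert H S)"
  have "Z = ?Z1 \<union> ?Z2" using GH unfolding S zero_set_def by auto
  moreover have "alg_closed_set ?Z1" "alg_closed_set ?Z2" unfolding alg_closed_set_def by blast+
  ultimately have "Z = ?Z1 \<or> Z = ?Z2" using assms unfolding alg_irreducible_def by blast
  then show "(\<forall>z\<in>Z. poly_eval G z = 0) \<or> (\<forall>z\<in>Z. poly_eval H z = 0)"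
    unfolding zero_set_def by blast
qed

lemma prime_locus_UNIV: "prime_locus (UNIV :: (complex ^ 's::{finite,linorder}) set)"
  unfolding prime_locus_def
proof (intro allI impI)
  fix G H :: "'s cpoly" assume "\<forall>z\<in>UNIV. poly_eval (G * H) z = 0"
  then have "G * H = 0" using nonzero_imp_nonvanishing[of "G * H"] by blast
  then show "(\<forall>z\<in>UNIV. poly_eval G z = 0) \<or> (\<forall>z\<in>UNIV. poly_eval H z = 0)" by auto
qed

text \<open>The product of the \<open>f i ^ k\<^sub>i\<close>, the exponents being listed from the highest index
  down to \<open>0\<close>, so that a new polynomial \<open>f r\<close> goes in front of a list of length \<open>r\<close>.\<close>

fun power_product :: "(nat \<Rightarrow> 's cpoly) \<Rightarrow> nat list \<Rightarrow> 's cpoly" where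
  "power_product f [] = 1"
| "power_product f (k # l) = f (length l) ^ k * power_product f l"

definition exponents :: "nat \<Rightarrow> nat \<Rightarrow> nat list set" where
  "exponents D r = {l. set l \<subseteq> {..<D} \<and> length l = r}"

lemma exponents_0: "exponents D 0 = {[]}"
  by (auto simp: exponents_def)

lemma exponents_Suc: "exponents D (Suc r) = (\<lambda>(k, l). k # l) ` ({..<D} \<times> exponents D r)"
  by (auto simp: exponents_def length_Suc_conv image_iff)

lemma finite_exponents [simp]: "finite (exponents D r)"
  unfolding exponents_def by (rule finite_lists_length_eq) simp

lemma card_exponents: "card (exponents D r) = D ^ r"
  unfolding exponents_def by (subst card_lists_length_eq) simp_all

lemma sum_exponents_Suc:
  "(\<Sum>l\<in>exponents D (Suc r). h l) = (\<Sum>l\<in>exponents D r. \<Sum>k<D. h (k # l))"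
proof -
  have "(\<Sum>l\<in>exponents D (Suc r). h l) = (\<Sum>x\<in>{..<D} \<times> exponents D r. h (fst x # snd x))"
    unfolding exponents_Suc by (subst sum.reindex) (auto simp: inj_on_def case_prod_beta)
  also have "\<dots> = (\<Sum>k<D. \<Sum>l\<in>exponents D r. h (k # l))"
    by (subst sum.cartesian_product) (simp add: case_prod_beta)
  also have "\<dots> = (\<Sum>l\<in>exponents D r. \<Sum>k<D. h (k # l))" by (rule sum.swap)
  finally show ?thesis .
qed

text \<open>The products of powers of \<open>f 0, \<dots>, f (r - 1)\<close> with exponents below \<open>D\<close> are linearly independent as functions
  on \<open>Z\<close>; for all \<open>D\<close> together this is algebraic independence.\<close>

definition independent_on :: "nat \<Rightarrow> nat \<Rightarrow> (nat \<Rightarrow> 's::finite cpoly) \<Rightarrow> (complex ^ 's) set \<Rightarrow> bool" where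
  "independent_on D r f Z \<longleftrightarrow>
     (\<forall>c. (\<forall>z\<in>Z. (\<Sum>l\<in>exponents D r. c l * poly_eval (power_product f l) z) = 0) \<longrightarrow>
          (\<forall>l\<in>exponents D r. c l = 0))"

lemma independent_onD:
  assumes "independent_on D r f Z"
    and "\<And>z. z \<in> Z \<Longrightarrow> (\<Sum>l\<in>exponents D r. c l * poly_eval (power_product f l) z) = 0"
    and "l \<in> exponents D r"
  shows "c l = 0"
proof -
  have "\<forall>z\<in>Z. (\<Sum>l\<in>exponents D r. c l * poly_eval (power_product f l) z) = 0"
    using assms(2) by (rule ballI)
  then have "\<forall>l\<in>exponents D r. c l = 0"
    using assms(1)[unfolded independent_on_def, THEN spec[of _ c]] by (rule rev_mp)
  then show ?thesis using assms(3) by (rule bspec)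
qed

text \<open>Suppose a relation on \<open>Z\<close> with lowest power \<open>k\<close> of \<open>f r\<close>. Since \<open>f r\<close> is not zero on \<open>Z\<close>
  and \<open>Z\<close> is irreducible, \<open>(f r) ^ k\<close> cancels. Restriction to \<open>Z'\<close>, where \<open>f r\<close> vanishes, leaves the terms with
  power exactly \<open>k\<close>, a relation among the earlier polynomials.\<close>

lemma independent_on_Suc:
  assumes prime: "prime_locus Z" and indep: "independent_on D r f Z'"
    and "Z' \<subseteq> Z" and vanish: "\<And>z. z \<in> Z' \<Longrightarrow> poly_eval (f r) z = 0"
    and z0: "z0 \<in> Z" "poly_eval (f r) z0 \<noteq> 0"
  shows "independent_on D (Suc r) f Z"
  unfolding independent_on_def
proof (intro allI impI)
  fix c assume rel: "\<forall>z\<in>Z. (\<Sum>l\<in>exponents D (Suc r). c l * poly_eval (power_product f l) z) = 0"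
  have len: "length l = r" if "l \<in> exponents D r" for l
    using that by (simp add: exponents_def)
  have rel': "(\<Sum>l\<in>exponents D r. \<Sum>m<D. c (m # l) * (poly_eval (f r) z ^ m * poly_eval (power_product f l) z)) = 0"
    if z: "z \<in> Z" for z
  proof -
    have "(\<Sum>l\<in>exponents D (Suc r). c l * poly_eval (power_product f l) z) = 0" using rel z by blast
    then show ?thesis unfolding sum_exponents_Suc by (simp add: len)
  qed
  have "k < D \<longrightarrow> (\<forall>l\<in>exponents D r. c (k # l) = 0)" for k
  proof (induction k rule: less_induct)
    case (less k)
    show ?case
    proof
      assume "k < D"
      define G where "G = (\<Sum>l\<in>exponents D r. \<Sum>m\<in>{k..<D}.
        const_poly (c (m # l)) * (f r ^ (m - k) * power_product f l))"
      have "poly_eval (f r ^ k * G) z = 0" if z: "z \<in> Z" for z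
      proof -
        \<comment> \<open>The terms with powers below \<open>k\<close> vanish by the induction hypothesis.\<close>
        have A: "(\<Sum>m\<in>{k..<D}. c (m # l) * (poly_eval (f r) z ^ m * poly_eval (power_product f l) z))
            = (\<Sum>m<D. c (m # l) * (poly_eval (f r) z ^ m * poly_eval (power_product f l) z))"
          if l: "l \<in> exponents D r" for l
          using less.IH \<open>k < D\<close> l by (intro sum.mono_neutral_left) auto
        have B: "poly_eval (f r) z ^ k * (c (m # l) * (poly_eval (f r) z ^ (m - k) * poly_eval (power_product f l) z))
            = c (m # l) * (poly_eval (f r) z ^ m * poly_eval (power_product f l) z)"
          if m: "m \<in> {k..<D}" for m l
        proof -
          have "poly_eval (f r) z ^ m = poly_eval (f r) z ^ k * poly_eval (f r) z ^ (m - k)"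
            using m by (simp flip: power_add)
          then show ?thesis by (simp add: ac_simps)
        qed
        have "poly_eval (f r ^ k * G) z = (\<Sum>l\<in>exponents D r. \<Sum>m\<in>{k..<D}.
            poly_eval (f r) z ^ k * (c (m # l) * (poly_eval (f r) z ^ (m - k) * poly_eval (power_product f l) z)))"
          unfolding G_def by (simp add: poly_eval_sum sum_distrib_left)
        also have "\<dots> = (\<Sum>l\<in>exponents D r. \<Sum>m\<in>{k..<D}.
            c (m # l) * (poly_eval (f r) z ^ m * poly_eval (power_product f l) z))"
          by (intro sum.cong refl B)
        also have "\<dots> = (\<Sum>l\<in>exponents D r. \<Sum>m<D.
            c (m # l) * (poly_eval (f r) z ^ m * poly_eval (power_product f l) z))"
          by (intro sum.cong refl A)
        finally show ?thesis using rel'[OF z] by simp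
      qed
      moreover have "\<not> (\<forall>z\<in>Z. poly_eval (f r ^ k) z = 0)" using z0 by auto
      ultimately have G: "\<forall>z\<in>Z. poly_eval G z = 0"
        using prime[unfolded prime_locus_def, rule_format, of "f r ^ k" G] by blast
      have rel_k: "(\<Sum>l\<in>exponents D r. c (k # l) * poly_eval (power_product f l) z) = 0" if z: "z \<in> Z'" for z
      proof -
        have "(\<Sum>m\<in>{k..<D}. c (m # l) * (0 ^ (m - k) * x)) = c (k # l) * x" for l and x :: complex
        proof -
          have "(\<Sum>m\<in>{k..<D}. c (m # l) * (0 ^ (m - k) * x)) = (\<Sum>m\<in>{k}. c (m # l) * (0 ^ (m - k) * x))"
            using \<open>k < D\<close> by (intro sum.mono_neutral_right) auto
          then show ?thesis by simp
        qed
        then have "poly_eval G z = (\<Sum>l\<in>exponents D r. c (k # l) * poly_eval (power_product f l) z)"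
          unfolding G_def by (simp add: poly_eval_sum vanish[OF z])
        then show ?thesis using G z \<open>Z' \<subseteq> Z\<close> by auto
      qed
      show "\<forall>l\<in>exponents D r. c (k # l) = 0"
        by (rule ballI) (rule independent_onD[OF indep, of "\<lambda>l. c (k # l)", OF rel_k])
    qed
  qed
  then show "\<forall>l\<in>exponents D (Suc r). c l = 0" unfolding exponents_Suc by (intro ballI) auto
qed

definition exponents_le :: "nat \<Rightarrow> 's cpoly \<Rightarrow> bool" where
  "exponents_le d F \<longleftrightarrow> (\<forall>m\<in>mkeys F. \<forall>j. lk m j \<le> d)"

lemma exponents_le_mult: "exponents_le d F \<Longrightarrow> exponents_le e G \<Longrightarrow> exponents_le (d + e) (F * G)"
proof -
  assume F: "exponents_le d F" and G: "exponents_le e G"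
  have "lk m j \<le> d + e" if m: "m \<in> mkeys (F * G)" for m j
  proof -
    obtain a b where "m = a + b" "a \<in> mkeys F" "b \<in> mkeys G"
      using m Poly_Mapping.keys_mult[of F G] by blast
    then show ?thesis using F G by (simp add: exponents_le_def lookup_add add_mono)
  qed
  then show ?thesis by (simp add: exponents_le_def)
qed

lemma exponents_le_one: "exponents_le d 1"
  by (simp add: exponents_le_def)

lemma exponents_le_weaken: "exponents_le d F \<Longrightarrow> d \<le> e \<Longrightarrow> exponents_le e F"
  by (auto simp: exponents_le_def intro: le_trans[of _ d])

lemma exponents_le_power: "exponents_le d F \<Longrightarrow> exponents_le (k * d) (F ^ k)"
  by (induction k) (simp_all add: exponents_le_one exponents_le_mult)

lemma exponents_le_exists: "\<exists>d. exponents_le d (F :: 's::finite cpoly)"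
proof -
  define A where "A = (\<lambda>(m, j). lk m j) ` (mkeys F \<times> (UNIV :: 's set))"
  have fin: "finite A" unfolding A_def by simp
  have "lk m j \<le> Max A" if "m \<in> mkeys F" for m j
  proof (rule Max_ge)
    show "lk m j \<in> A" unfolding A_def by (rule image_eqI[of _ _ "(m, j)"]) (use that in simp_all)
  qed (rule fin)
  then show ?thesis unfolding exponents_le_def by blast
qed

lemma exponents_le_power_product:
  assumes "\<And>i. i < r \<Longrightarrow> exponents_le d (f i)" "l \<in> exponents D k" "k \<le> r"
  shows "exponents_le (k * (D * d)) (power_product f l)"
  using assms(2,3)
proof (induction k arbitrary: l)
  case 0
  then show ?case by (simp add: exponents_0 exponents_le_one)
next
  case (Suc k)
  then obtain a l' where l: "l = a # l'" "a < D" "l' \<in> exponents D k"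
    by (auto simp: exponents_Suc)
  have "exponents_le (a * d) (f k ^ a)" using assms(1) Suc.prems by (intro exponents_le_power) simp
  then have "exponents_le (D * d) (f k ^ a)" by (rule exponents_le_weaken) (use l in simp)
  moreover have "exponents_le (k * (D * d)) (power_product f l')" using Suc.IH l Suc.prems by simp
  ultimately have "exponents_le (D * d + k * (D * d)) (f k ^ a * power_product f l')"
    by (rule exponents_le_mult)
  then show ?case using l by (simp add: exponents_def)
qed

lemma card_bounded_mindex:
  defines "M \<equiv> \<lambda>d. {m :: 's::finite mindex. \<forall>j. lk m j \<le> d}"
  shows "finite (M d)" "card (M d) \<le> Suc d ^ CARD('s)"
proof -
  have inj: "inj_on lk (M d)" by (intro inj_onI poly_mapping_eqI) simp
  have sub: "lk ` M d \<subseteq> (\<Pi>\<^sub>E j\<in>UNIV. {..d})" by (auto simp: M_def PiE_def)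
  have fin: "finite (\<Pi>\<^sub>E j\<in>(UNIV :: 's set). {..d})" by (intro finite_PiE) auto
  show "finite (M d)" using finite_imageD[OF finite_subset[OF sub fin] inj] .
  show "card (M d) \<le> Suc d ^ CARD('s)"
    using card_inj_on_le[OF inj sub fin] by (simp add: card_PiE)
qed

interpretation cpoly_vs: vector_space "\<lambda>c (G :: 's::{finite,linorder} cpoly). const_poly c * G"
  by unfold_locales
    (simp_all add: const_poly_def single_add mult_single algebra_simps flip: mult.assoc)

text \<open>The \<open>D ^ r\<close> products lie in the space of polynomials with all exponents at most \<open>r D d\<close>.\<close>

lemma independent_on_UNIV_bound:
  fixes f :: "nat \<Rightarrow> 's::{finite,linorder} cpoly"
  assumes indep: "independent_on D r f UNIV" and f: "\<And>i. i < r \<Longrightarrow> exponents_le d (f i)"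
  shows "D ^ r \<le> Suc (r * (D * d)) ^ CARD('s)"
proof -
  let ?E = "exponents D r" and ?p = "power_product f"
  define M where "M = {m :: 's mindex. \<forall>j. lk m j \<le> r * (D * d)}"
  have M: "finite M" "card M \<le> Suc (r * (D * d)) ^ CARD('s)"
    unfolding M_def by (rule card_bounded_mindex)+
  have inj: "inj_on ?p ?E"
  proof (rule inj_onI, rule ccontr)
    fix l l' assume l: "l \<in> ?E" "l' \<in> ?E" "?p l = ?p l'" "l \<noteq> l'"
    \<comment> \<open>Two equal products would be a relation with coefficients \<open>1\<close> and \<open>-1\<close>.\<close>
    define c :: "nat list \<Rightarrow> complex" where "c x = (if x = l then 1 else 0) - (if x = l' then 1 else 0)" for x
    have "(\<Sum>x\<in>?E. c x * poly_eval (?p x) z) = 0" for z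
      using l by (simp add: c_def left_diff_distrib sum_subtractf if_distrib[of "\<lambda>a. a * _"] cong: if_cong)
    then have "c l = 0" using l(1) by (intro independent_onD[OF indep, of c])
    then show False using l(4) by (simp add: c_def)
  qed
  have "cpoly_vs.independent (?p ` ?E)"
  proof (rule cpoly_vs.independent_if_scalars_zero)
    fix g x assume g: "(\<Sum>x\<in>?p ` ?E. const_poly (g x) * x) = 0" and x: "x \<in> ?p ` ?E"
    have "(\<Sum>l\<in>?E. const_poly (g (?p l)) * ?p l) = 0" using g by (simp add: sum.reindex[OF inj])
    then have "poly_eval (\<Sum>l\<in>?E. const_poly (g (?p l)) * ?p l) z = 0" for z by simp
    then have "(\<Sum>l\<in>?E. g (?p l) * poly_eval (?p l) z) = 0" for z by (simp add: poly_eval_sum)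
    then have "\<forall>l\<in>?E. g (?p l) = 0"
      by (intro ballI independent_onD[OF indep, of "\<lambda>l. g (?p l)"])
    then show "g x = 0" using x by auto
  qed simp
  moreover have "?p ` ?E \<subseteq> cpoly_vs.span ((\<lambda>m. mterm m 1) ` M)"
  proof
    fix x assume "x \<in> ?p ` ?E"
    then have x: "exponents_le (r * (D * d)) x" using exponents_le_power_product[of r d f _ D r] f by auto
    have "(\<Sum>m\<in>mkeys x. const_poly (lk x m) * mterm m 1) \<in> cpoly_vs.span ((\<lambda>m. mterm m 1) ` M)"
      using x by (intro cpoly_vs.span_sum cpoly_vs.span_scale cpoly_vs.span_base)
        (auto simp: M_def exponents_le_def)
    moreover have "(\<Sum>m\<in>mkeys x. const_poly (lk x m) * mterm m 1) = x"
      unfolding const_poly_def mult_single by (simp flip: cpoly_eq_sum_monomials)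
    ultimately show "x \<in> cpoly_vs.span ((\<lambda>m. mterm m 1) ` M)" by simp
  qed
  ultimately have "card (?p ` ?E) \<le> card ((\<lambda>m. mterm m (1::complex)) ` M)"
    using cpoly_vs.independent_span_bound[of "(\<lambda>m. mterm m 1) ` M" "?p ` ?E"] M(1) by blast
  also have "\<dots> \<le> card M" using M(1) by (rule card_image_le)
  finally show ?thesis using M(2) by (simp add: card_image[OF inj] card_exponents)
qed

text \<open>For \<open>r > s\<close> the left side grows faster in \<open>D\<close> than the right side.\<close>

lemma length_bound_of_growth:
  fixes s r d :: nat
  assumes "\<And>D. D ^ r \<le> Suc (r * (D * d)) ^ s"
  shows "r \<le> s"
proof (rule ccontr)
  assume "\<not> r \<le> s"
  define D where "D = Suc (Suc (r * d) ^ s)"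
  have step: "Suc (r * (D * d)) \<le> D * Suc (r * d)"
  proof -
    have "1 \<le> D" by (simp add: D_def)
    moreover have "r * (D * d) = D * (r * d)" by (simp add: ac_simps)
    ultimately show ?thesis by simp
  qed
  have "D ^ Suc s \<le> D ^ r" using \<open>\<not> r \<le> s\<close> by (intro power_increasing) (auto simp: D_def)
  also have "\<dots> \<le> Suc (r * (D * d)) ^ s" by (rule assms)
  also have "\<dots> \<le> (D * Suc (r * d)) ^ s" using step by (rule power_mono) simp
  also have "\<dots> = D ^ s * Suc (r * d) ^ s" by (rule power_mult_distrib)
  finally have "D \<le> Suc (r * d) ^ s" by (simp add: D_def)
  then show False by (simp add: D_def)
qed

text \<open>The chain condition supplies, for each inclusion, a polynomial that vanishes on the
  smaller set but not on the larger one; these are independent on the last member, the whole space.\<close>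

theorem chain_length_bound:
  fixes Z :: "nat \<Rightarrow> (complex ^ 's::{finite,linorder}) set"
  assumes "Z 0 \<noteq> {}" and prime: "\<And>i. i \<le> r \<Longrightarrow> prime_locus (Z i)" and UNIV: "Z r = UNIV"
    and chain: "\<And>i. i < r \<Longrightarrow> alg_closed_set (Z i) \<and> Z i \<subset> Z (Suc i)"
  shows "r \<le> CARD('s)"
proof -
  have "\<exists>G. (\<forall>z\<in>Z i. poly_eval G z = 0) \<and> (\<exists>z\<in>Z (Suc i). poly_eval G z \<noteq> 0)" if i: "i < r" for i
  proof -
    obtain S z where "Z i = zero_set S" "z \<in> Z (Suc i)" "z \<notin> Z i"
      using chain[OF i] unfolding alg_closed_set_def by blast
    then show ?thesis unfolding zero_set_def by blast
  qed
  then obtain f where f: "\<And>i. i < r \<Longrightarrow> \<forall>z\<in>Z i. poly_eval (f i) z = 0"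
    "\<And>i. i < r \<Longrightarrow> \<exists>z\<in>Z (Suc i). poly_eval (f i) z \<noteq> 0" by metis
  have indep: "independent_on D i f (Z i)" if "i \<le> r" for D i
    using that
  proof (induction i)
    case 0
    then show ?case using assms(1) by (auto simp: independent_on_def exponents_0)
  next
    case (Suc i)
    then obtain z where "z \<in> Z (Suc i)" "poly_eval (f i) z \<noteq> 0" using f(2)[of i] by auto
    then show ?case
      using Suc f(1)[of i] chain[of i] prime[of "Suc i"] by (intro independent_on_Suc[of _ D i f "Z i"]) auto
  qed
  have "\<forall>i. \<exists>d. exponents_le d (f i)" by (intro allI exponents_le_exists)
  then obtain e where e: "\<And>i. exponents_le (e i) (f i)" by metis
  have bound: "exponents_le (\<Sum>i<r. e i) (f i)" if i: "i < r" for i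
    by (rule exponents_le_weaken[OF e]) (use i in \<open>simp add: member_le_sum\<close>)
  have "D ^ r \<le> Suc (r * (D * (\<Sum>i<r. e i))) ^ CARD('s)" for D
  proof (rule independent_on_UNIV_bound[OF _ bound])
    show "independent_on D r f UNIV" using indep[of r D] UNIV by simp
  qed
  then show ?thesis by (rule length_bound_of_growth)
qed

text \<open>A chain inside the hypersurface can be prolonged by the whole space.\<close>

theorem local_dim_hypersurface_le:
  fixes F :: "'s::{finite,linorder} cpoly"
  assumes "F \<noteq> 0"
  shows "local_dim (zero_set {F}) p \<le> enat (CARD('s) - 1)"
  unfolding local_dim_def
proof (rule Sup_least, elim CollectE exE conjE)
  fix x r Z
  assume x: "x = enat r" and Z: "\<forall>i\<le>r. alg_irreducible (Z i) \<and> p \<in> Z i \<and> Z i \<subseteq> zero_set {F}"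
    and strict: "\<forall>i<r. Z i \<subset> Z (Suc i)"
  define Y where "Y i = (if i \<le> r then Z i else UNIV)" for i
  obtain q where "poly_eval F q \<noteq> 0" using nonzero_imp_nonvanishing[OF assms] by blast
  then have "q \<notin> zero_set {F}" by (simp add: zero_set_def)
  then have top: "Z r \<subset> UNIV" using Z by blast
  have "Suc r \<le> CARD('s)"
  proof (rule chain_length_bound[of Y])
    show "Y 0 \<noteq> {}" using Z by (auto simp: Y_def)
    show "prime_locus (Y i)" if "i \<le> Suc r" for i
      using Z alg_irreducible_imp_prime_locus[of "Z i"] by (simp add: Y_def prime_locus_UNIV)
    show "Y (Suc r) = UNIV" by (simp add: Y_def)
    show "alg_closed_set (Y i) \<and> Y i \<subset> Y (Suc i)" if i: "i < Suc r" for i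
    proof (cases "i = r")
      case True
      then show ?thesis using top Z by (simp add: Y_def alg_irreducible_def)
    next
      case False
      then show ?thesis using i Z strict by (simp add: Y_def alg_irreducible_def)
    qed
  qed
  then show "x \<le> enat (CARD('s) - 1)" by (simp add: x)
qed

section \<open>Lower bound for the dimension at a point with non-zero gradient\<close>

text \<open>Keeps the coordinates in \<open>S\<close> and resets the others to those of \<open>p\<close>.\<close>

definition freeze :: "'s set \<Rightarrow> complex ^ 's \<Rightarrow> complex ^ 's \<Rightarrow> complex ^ 's" where
  "freeze S p x = (\<chi> i. if i \<in> S then x $ i else p $ i)"

lemma freeze_nth [simp]: "freeze S p x $ i = (if i \<in> S then x $ i else p $ i)"
  by (simp add: freeze_def)

lemma freeze_eq_iff: "freeze S p x = x \<longleftrightarrow> (\<forall>i. i \<notin> S \<longrightarrow> x $ i = p $ i)"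
  by (auto simp: Finite_Cartesian_Product.vec_eq_iff)

lemma freeze_same [simp]: "freeze S p p = p"
  by (simp add: freeze_eq_iff)

lemma poly_eval_freeze:
  "vars_in S F \<Longrightarrow> poly_eval F (freeze S p x) = poly_eval F x"
  by (rule poly_eval_cong_vars) auto

lemma poly_eval_prod: "poly_eval (\<Prod>a\<in>A. F a) p = (\<Prod>a\<in>A. poly_eval (F a) p)"
  by (induction A rule: infinite_finite_induct) simp_all

lemma vars_in_prod: "(\<And>a. a \<in> A \<Longrightarrow> vars_in S (F a)) \<Longrightarrow> vars_in S (prod F A)"
  by (induction A rule: infinite_finite_induct) (simp_all add: vars_in_mult)

lemma substitution_exists:
  fixes G :: "'s::finite cpoly"
  shows "\<exists>G'. vars_in S G' \<and> (\<forall>x. poly_eval G' x = poly_eval G (freeze S p x))"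
proof (induction G rule: cpoly_induct)
  case zero
  show ?case by (rule exI[of _ 0]) simp
next
  case (monomial m c)
  define G' where "G' = const_poly (c * (\<Prod>i\<in>- S. (p $ i) ^ lk m i)) * (\<Prod>i\<in>S. xpow i (lk m i))"
  have "vars_in S G'"
    unfolding G'_def by (intro vars_in_mult vars_in_const vars_in_prod vars_in_xpow)
  moreover have "poly_eval G' x = poly_eval (mterm m c) (freeze S p x)" for x
  proof -
    have "mono_eval m (freeze S p x)
        = (\<Prod>i\<in>UNIV. if i \<in> S then (x $ i) ^ lk m i else (p $ i) ^ lk m i)"
      unfolding mono_eval_def by (intro prod.cong) auto
    also have "\<dots> = (\<Prod>i\<in>S. (x $ i) ^ lk m i) * (\<Prod>i\<in>- S. (p $ i) ^ lk m i)"
      by (subst prod.If_cases) (simp_all add: Collect_mem_eq)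
    finally show ?thesis by (simp add: G'_def poly_eval_prod ac_simps)
  qed
  ultimately show ?case by blast
next
  case (plus F G)
  then obtain F' G' where "vars_in S F'" "\<forall>x. poly_eval F' x = poly_eval F (freeze S p x)"
    "vars_in S G'" "\<forall>x. poly_eval G' x = poly_eval G (freeze S p x)" by blast
  then show ?case by (intro exI[of _ "F' + G'"]) (simp add: vars_in_add)
qed

text \<open>The zeros of \<open>f\<close> in the coordinate subspace through \<open>p\<close> in the directions \<open>S\<close>.\<close>

definition slice_locus :: "'s::finite set \<Rightarrow> 's cpoly \<Rightarrow> complex ^ 's \<Rightarrow> (complex ^ 's) set" where
  "slice_locus S f p = {x. freeze S p x = x \<and> poly_eval f x = 0}"

lemma freeze_in_slice_locus:
  assumes "vars_in S f" "poly_eval f x = 0"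
  shows "freeze S p x \<in> slice_locus S f p"
  using assms by (simp add: slice_locus_def poly_eval_freeze freeze_eq_iff)

lemma alg_closed_slice_locus: "alg_closed_set (slice_locus S f p)"
proof -
  have "slice_locus S f p = zero_set (insert f ((\<lambda>i. xpow i 1 - const_poly (p $ i)) ` (- S)))"
    by (auto simp: slice_locus_def zero_set_def freeze_eq_iff)
  then show ?thesis unfolding alg_closed_set_def by blast
qed

text \<open>Freezing turns a polynomial that vanishes on the slice into one that vanishes on the whole hypersurface of \<open>f\<close>, hence
  into a multiple of \<open>f\<close>. As \<open>f\<close> is prime, a product vanishes on the slice only if a factor
  does.\<close>

lemma alg_irreducible_slice_locus:
  fixes f :: "'s::{finite,linorder} cpoly"
  assumes "irreducible f" "vars_in S f" "poly_eval f p = 0"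
  shows "alg_irreducible (slice_locus S f p)"
  unfolding alg_irreducible_def
proof (intro conjI allI impI)
  let ?Z = "slice_locus S f p"
  show "alg_closed_set ?Z" by (rule alg_closed_slice_locus)
  show "?Z \<noteq> {}" using freeze_in_slice_locus[OF assms(2,3)] by blast
  fix Z1 Z2 assume Z: "alg_closed_set Z1" "alg_closed_set Z2" "?Z = Z1 \<union> Z2"
  obtain S1 S2 where S12: "Z1 = zero_set S1" "Z2 = zero_set S2"
    using Z(1,2) unfolding alg_closed_set_def by blast
  show "?Z = Z1 \<or> ?Z = Z2"
  proof (rule ccontr)
    assume "\<not> (?Z = Z1 \<or> ?Z = Z2)"
    then obtain x1 x2 where x: "x1 \<in> ?Z" "x1 \<notin> Z1" "x2 \<in> ?Z" "x2 \<notin> Z2" using Z(3) by blast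
    obtain G1 where G1: "G1 \<in> S1" "poly_eval G1 x1 \<noteq> 0" using x(2) unfolding S12 zero_set_def by blast
    obtain G2 where G2: "G2 \<in> S2" "poly_eval G2 x2 \<noteq> 0" using x(4) unfolding S12 zero_set_def by blast
    obtain H1 where H1: "\<forall>x. poly_eval H1 x = poly_eval G1 (freeze S p x)"
      using substitution_exists by blast
    obtain H2 where H2: "\<forall>x. poly_eval H2 x = poly_eval G2 (freeze S p x)"
      using substitution_exists by blast
    have "poly_eval (H1 * H2) y = 0" if y: "poly_eval f y = 0" for y
    proof -
      have "freeze S p y \<in> Z1 \<union> Z2" unfolding Z(3)[symmetric] by (rule freeze_in_slice_locus[OF assms(2) y])
      then have "poly_eval G1 (freeze S p y) = 0 \<or> poly_eval G2 (freeze S p y) = 0"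
        using G1(1) G2(1) unfolding S12 zero_set_def by blast
      then show ?thesis using H1 H2 by auto
    qed
    then have "f dvd H1 * H2" by (rule irreducible_dvd_if_vanishing[OF assms(1)])
    then have "f dvd H1 \<or> f dvd H2" by (rule irreducible_imp_prime[OF assms(1)])
    moreover have "poly_eval H x = 0" if "f dvd H" "x \<in> ?Z" for H x
      using that unfolding dvd_def slice_locus_def by auto
    ultimately have "poly_eval H1 x1 = 0 \<or> poly_eval H2 x2 = 0" using x(1,3) by blast
    then show False using H1 H2 G1(2) G2(2) x(1,3) by (auto simp: slice_locus_def)
  qed
qed

lemma irreducible_factor_through_point:
  fixes F :: "'s::{finite,linorder} cpoly"
  assumes "F \<noteq> 0" "poly_eval F p = 0"
  shows "\<exists>f. irreducible f \<and> f dvd F \<and> poly_eval f p = 0"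
  using assms
proof (induction F rule: cpoly_factor_induct)
  case (unit u)
  then obtain c where "c \<noteq> 0" "u = const_poly c" using is_unit_iff_const by blast
  then show ?case using unit by simp
next
  case (irreducible f H)
  show ?case
  proof (cases "poly_eval f p = 0")
    case True
    then show ?thesis using irreducible(1) by (intro exI[of _ f]) simp
  next
    case False
    then obtain g where "irreducible g" "g dvd H" "poly_eval g p = 0"
      using irreducible by auto
    then show ?thesis by (intro exI[of _ g]) (simp add: dvd_mult)
  qed
qed

text \<open>By the product rule, a factor through \<open>p\<close> inherits the non-zero derivative at \<open>p\<close>.\<close>

lemma smooth_irreducible_factor:
  fixes F :: "'s::{finite,linorder} cpoly"
  assumes "poly_eval F p = 0" "poly_eval (partial_deriv j F) p \<noteq> 0" "vars_in S F"
  obtains f where "irreducible f" "f dvd F" "vars_in S f" "poly_eval f p = 0"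
    "poly_eval (partial_deriv j f) p \<noteq> 0"
proof -
  have "F \<noteq> 0"
  proof
    assume "F = 0"
    then show False using assms(2) by (simp add: partial_deriv_def)
  qed
  then obtain f where f: "irreducible f" "f dvd F" "poly_eval f p = 0"
    using irreducible_factor_through_point assms(1) by blast
  then obtain H where H: "F = f * H" unfolding dvd_def by blast
  have "vars_in S f" using vars_in_factor(1)[of S f H] assms(3) \<open>F \<noteq> 0\<close> unfolding H by simp
  moreover have "poly_eval (partial_deriv j f) p \<noteq> 0"
    using assms(2) f(3) unfolding H partial_deriv_eval_mult by auto
  ultimately show ?thesis using f by (intro that)
qed

text \<open>Otherwise \<open>f\<close> would divide \<open>x\<^sub>i - p\<^sub>i\<close>. The cofactor \<open>w\<close> vanishes at \<open>p\<close>, since differentiating \<open>f w = x\<^sub>i - p\<^sub>i\<close>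
  along \<open>x\<^sub>j\<close> gives zero; but then differentiating along \<open>x\<^sub>i\<close> gives zero as well,
  instead of one.\<close>

lemma slice_locus_strict:
  fixes f :: "'s::{finite,linorder} cpoly"
  assumes f: "irreducible f" "vars_in S f" "poly_eval f p = 0" "poly_eval (partial_deriv j f) p \<noteq> 0"
    and i: "i \<in> S" "i \<noteq> j"
  shows "\<exists>x\<in>slice_locus S f p. x $ i \<noteq> p $ i"
proof (rule ccontr)
  assume flat: "\<not> (\<exists>x\<in>slice_locus S f p. x $ i \<noteq> p $ i)"
  define L where "L = xpow i 1 - const_poly (p $ i)"
  have L: "poly_eval L x = x $ i - p $ i" for x by (simp add: L_def)
  have "poly_eval L x = 0" if "poly_eval f x = 0" for x
  proof -
    have "freeze S p x $ i = p $ i" using flat freeze_in_slice_locus[OF f(2) that, of p] by blast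
    then show ?thesis using i(1) by (simp add: L)
  qed
  then have "f dvd L" by (rule irreducible_dvd_if_vanishing[OF f(1)])
  then obtain w where w: "L = f * w" unfolding dvd_def by blast
  have "poly_eval (partial_deriv j L) p = poly_eval (partial_deriv j 0) p"
    by (rule partial_deriv_eval_cong) (use i(2) in \<open>simp add: L\<close>)
  then have "poly_eval (partial_deriv j f) p * poly_eval w p = 0"
    unfolding w partial_deriv_eval_mult f(3) by (simp add: partial_deriv_def)
  then have "poly_eval w p = 0" using f(4) by simp
  then have zero: "poly_eval (partial_deriv i L) p = 0"
    unfolding w partial_deriv_eval_mult f(3) by simp
  have "((\<lambda>t. t - p $ i) has_field_derivative 1) (at (p $ i))"
    by (auto intro!: derivative_eq_intros)
  then have "((\<lambda>t. poly_eval L (point_upd p i t)) has_field_derivative 1) (at (p $ i))"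
    by (simp add: L)
  from DERIV_unique[OF partial_deriv_has_derivative this] show False using zero by simp
qed

text \<open>Freezing a coordinate \<open>i \<noteq> j\<close> keeps the derivative of \<open>f\<close> along \<open>x\<^sub>j\<close> at \<open>p\<close>. So the frozen polynomial
  is not zero and has an irreducible factor \<open>h\<close> through \<open>p\<close> to which induction applies; its
  slice lies properly inside that of \<open>f\<close>.\<close>

lemma smooth_chain_exists:
  fixes f :: "'s::{finite,linorder} cpoly"
  assumes "card S = Suc n" "j \<in> S" "irreducible f" "vars_in S f" "poly_eval f p = 0"
    "poly_eval (partial_deriv j f) p \<noteq> 0"
  shows "\<exists>Z. (\<forall>i\<le>n. alg_irreducible (Z i) \<and> p \<in> Z i \<and> Z i \<subseteq> slice_locus S f p)
    \<and> (\<forall>i<n. Z i \<subset> Z (Suc i))"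
  using assms
proof (induction n arbitrary: S f)
  case 0
  have "p \<in> slice_locus S f p" using freeze_in_slice_locus[OF 0(4,5), of p] by simp
  then show ?case
    using alg_irreducible_slice_locus[OF 0(3-5)] by (intro exI[of _ "\<lambda>_. slice_locus S f p"]) simp
next
  case (Suc n)
  have "S \<noteq> {j}" using Suc.prems(1) by auto
  then obtain i where i: "i \<in> S" "i \<noteq> j" using Suc.prems(2) by blast
  let ?S = "S - {i}"
  obtain g where g: "vars_in ?S g" "\<forall>x. poly_eval g x = poly_eval f (freeze ?S p x)"
    using substitution_exists by blast
  have gp: "poly_eval g p = 0" using g(2) Suc.prems(5) by simp
  have "poly_eval (partial_deriv j g) p = poly_eval (partial_deriv j f) p"
  proof (rule partial_deriv_eval_cong)
    fix t
    have "freeze ?S p (point_upd p j t) = point_upd p j t"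
      using i(2) Suc.prems(2) by (auto simp: freeze_eq_iff)
    then show "poly_eval g (point_upd p j t) = poly_eval f (point_upd p j t)" using g(2) by simp
  qed
  then have g': "poly_eval (partial_deriv j g) p \<noteq> 0" using Suc.prems(6) by simp
  obtain h where h: "irreducible h" "h dvd g" "vars_in ?S h" "poly_eval h p = 0"
    "poly_eval (partial_deriv j h) p \<noteq> 0"
    by (rule smooth_irreducible_factor[OF gp g' g(1)])
  have "card ?S = Suc n" using Suc.prems(1) i(1) by simp
  moreover have "j \<in> ?S" using Suc.prems(2) i(2) by simp
  ultimately obtain Z where
    Z: "\<forall>k\<le>n. alg_irreducible (Z k) \<and> p \<in> Z k \<and> Z k \<subseteq> slice_locus ?S h p" "\<forall>k<n. Z k \<subset> Z (Suc k)"
    using Suc.IH[OF _ _ h(1,3,4,5)] by blast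
  let ?W = "slice_locus S f p"
  have sub: "x \<in> ?W \<and> x $ i = p $ i" if x: "x \<in> slice_locus ?S h p" for x
  proof -
    have fx: "freeze ?S p x = x" and hx: "poly_eval h x = 0" using x by (simp_all add: slice_locus_def)
    have "poly_eval g x = 0" using h(2) hx unfolding dvd_def by auto
    then have "poly_eval f x = 0" using g(2) fx by simp
    moreover have "freeze S p x = x" "x $ i = p $ i" using fx by (auto simp: freeze_eq_iff)
    ultimately show ?thesis by (simp add: slice_locus_def)
  qed
  obtain y where y: "y \<in> ?W" "y $ i \<noteq> p $ i"
    using slice_locus_strict[OF Suc.prems(3-6) i] by blast
  have Zn: "Z n \<subset> ?W"
  proof -
    have "Z n \<subseteq> ?W" using Z(1) sub by blast
    moreover have "y \<notin> Z n" using Z(1) sub y(2) by blast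
    ultimately show ?thesis using y(1) by blast
  qed
  have W: "alg_irreducible ?W" "p \<in> ?W"
    using alg_irreducible_slice_locus[OF Suc.prems(3-5)] freeze_in_slice_locus[OF Suc.prems(4,5), of p]
    by simp_all
  define Y where "Y k = (if k \<le> n then Z k else ?W)" for k
  have "alg_irreducible (Y k) \<and> p \<in> Y k \<and> Y k \<subseteq> ?W" if "k \<le> Suc n" for k
  proof (cases "k \<le> n")
    case True
    then have "Z k \<subseteq> ?W" using Z(1) sub by blast
    then show ?thesis using True Z(1) by (simp add: Y_def)
  next
    case False
    then show ?thesis using W by (simp add: Y_def)
  qed
  moreover have "Y k \<subset> Y (Suc k)" if k: "k < Suc n" for k
  proof (cases "k = n")
    case True
    then show ?thesis using Zn by (simp add: Y_def)
  next
    case False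
    then show ?thesis using k Z(2) by (simp add: Y_def)
  qed
  ultimately show ?case by blast
qed

theorem local_dim_hypersurface_ge:
  fixes F :: "'s::{finite,linorder} cpoly"
  assumes "poly_eval F p = 0" "poly_eval (partial_deriv j F) p \<noteq> 0"
  shows "enat (CARD('s) - 1) \<le> local_dim (zero_set {F}) p"
proof -
  obtain f where f: "irreducible f" "f dvd F" "vars_in UNIV f" "poly_eval f p = 0"
    "poly_eval (partial_deriv j f) p \<noteq> 0"
    by (rule smooth_irreducible_factor[OF assms vars_in_UNIV])
  have card: "CARD('s) = Suc (CARD('s) - 1)" by (rule Suc_pred'[OF zero_less_card_finite])
  obtain Z where Z: "\<forall>i\<le>CARD('s) - 1. alg_irreducible (Z i) \<and> p \<in> Z i \<and> Z i \<subseteq> slice_locus UNIV f p"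
    "\<forall>i<CARD('s) - 1. Z i \<subset> Z (Suc i)"
    using smooth_chain_exists[OF card UNIV_I f(1,3,4,5)] by blast
  have "slice_locus UNIV f p \<subseteq> zero_set {F}"
    using f(2) unfolding dvd_def slice_locus_def zero_set_def by auto
  then have "\<forall>i\<le>CARD('s) - 1. alg_irreducible (Z i) \<and> p \<in> Z i \<and> Z i \<subseteq> zero_set {F}"
    using Z(1) by blast
  then show ?thesis
    unfolding local_dim_def using Z(2)
    by (intro Sup_upper CollectI exI[of _ "CARD('s) - 1"] conjI exI[of _ Z] refl)
qed

theorem nonsingular_point_hypersurface_iff:
  fixes F :: "'s::{finite,linorder} cpoly"
  assumes "squarefree F" "F \<noteq> 0" "poly_eval F p = 0"
  shows "nonsingular_point (zero_set {F}) p \<longleftrightarrow> (\<exists>j. poly_eval (partial_deriv j F) p \<noteq> 0)"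
proof -
  let ?T = "tangent_space (zero_set {F}) p"
  have p: "p \<in> zero_set {F}" using assms(3) by (simp add: zero_set_def)
  have T: "?T = {v. (\<Sum>i\<in>UNIV. poly_eval (partial_deriv i F) p * v $ i) = 0}"
    by (rule tangent_space_hypersurface[OF assms])
  have card: "CARD('s) - 1 < CARD('s)" using zero_less_card_finite[where 'a = 's] by simp
  have le: "local_dim (zero_set {F}) p \<le> enat (CARD('s) - 1)"
    by (rule local_dim_hypersurface_le[OF assms(2)])
  show ?thesis
  proof
    assume nonsing: "nonsingular_point (zero_set {F}) p"
    show "\<exists>j. poly_eval (partial_deriv j F) p \<noteq> 0"
    proof (rule ccontr)
      assume "\<not> (\<exists>j. poly_eval (partial_deriv j F) p \<noteq> 0)"
      then have "?T = UNIV" unfolding T by simp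
      then have "vec.dim ?T = CARD('s)" by (simp only: vec_dim_card)
      then have "enat CARD('s) \<le> enat (CARD('s) - 1)"
        using nonsing le unfolding nonsingular_point_def by metis
      then show False using card unfolding enat_ord_simps by linarith
    qed
  next
    assume "\<exists>j. poly_eval (partial_deriv j F) p \<noteq> 0"
    then obtain j where j: "poly_eval (partial_deriv j F) p \<noteq> 0" ..
    have "vec.dim ?T = CARD('s) - 1"
      unfolding T by (rule dim_hyperplane[where g = "\<lambda>i. poly_eval (partial_deriv i F) p", OF j])
    moreover have "local_dim (zero_set {F}) p = enat (CARD('s) - 1)"
      using le local_dim_hypersurface_ge[OF assms(3) j] by (rule antisym)
    ultimately show "nonsingular_point (zero_set {F}) p"
      using p unfolding nonsingular_point_def by simp
  qed
qed

section \<open>Rank and left kernel of a matrix\<close>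

lemma (in vec_space) submodule_orthogonal:
  assumes "v \<in> carrier_vec n"
  shows "submodule class_ring {w \<in> carrier_vec n. Matrix.scalar_prod v w = 0} V"
proof (rule submodule.intro)
  let ?N = "{w \<in> carrier_vec n. Matrix.scalar_prod v w = 0}"
  show "?N \<subseteq> carrier V" by auto
  show "\<zero>\<^bsub>V\<^esub> \<in> ?N" using assms by (simp add: module_vec_simps)
  show "x \<oplus>\<^bsub>V\<^esub> y \<in> ?N" if "x \<in> ?N" "y \<in> ?N" for x y
    using assms that by (simp add: module_vec_simps scalar_prod_add_distrib[of _ n])
  show "c \<odot>\<^bsub>V\<^esub> x \<in> ?N" if "c \<in> carrier class_ring" "x \<in> ?N" for c :: 'a and x
    using assms that by (simp add: module_vec_simps)
qed (rule module_axioms)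

text \<open>Fewer than \<open>n\<close> vectors, padded with zero columns, form a singular square matrix, and its
  transpose is singular too.\<close>

lemma (in vec_space) orthogonal_vector_exists:
  fixes S :: "'a Matrix.vec set"
  assumes S: "S \<subseteq> carrier_vec n" "finite S" "card S < n"
  shows "\<exists>v\<in>carrier_vec n. v \<noteq> 0\<^sub>v n \<and> (\<forall>x\<in>S. Matrix.scalar_prod v x = 0)"
proof -
  obtain xs where xs: "set xs = S" "distinct xs" using finite_distinct_list[OF S(2)] by blast
  then have len: "length xs < n" using S(3) distinct_card[OF xs(2)] by simp
  define ys where "ys = xs @ replicate (n - length xs) (0\<^sub>v n)"
  define B where "B = mat_of_cols n ys"
  have ys: "length ys = n" using len by (simp add: ys_def)
  have ys_dim: "ys ! i \<in> carrier_vec n" if "i < n" for i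
  proof -
    have "ys ! i \<in> set ys" using that ys by simp
    then show ?thesis using xs(1) S(1) by (auto simp: ys_def)
  qed
  have B: "B \<in> carrier_mat n n" unfolding B_def using mat_of_cols_carrier(1)[of n ys] ys by simp
  have col: "col B i = ys ! i" if "i < n" for i
    unfolding B_def using that ys ys_dim by (intro col_mat_of_cols) simp_all
  have "\<not> n - 1 < length xs" "n - 1 - length xs < n - length xs" using len by simp_all
  then have "ys ! (n - 1) = 0\<^sub>v n" unfolding ys_def nth_append by (simp only: if_False) (rule List.nth_replicate)
  then have last: "col B (n - 1) = 0\<^sub>v n" using col[of "n - 1"] len by simp
  have "B *\<^sub>v unit_vec n (n - 1) = 0\<^sub>v n"
  proof (rule eq_vecI)
    fix i assume "i < dim_vec (0\<^sub>v n :: 'a Matrix.vec)"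
    then have i: "i < n" by simp
    then have "vec_index (B *\<^sub>v unit_vec n (n - 1)) i = B $$ (i, n - 1)"
      using B len by (simp add: scalar_prod_right_unit)
    also have "\<dots> = vec_index (col B (n - 1)) i" using B i len by simp
    finally show "vec_index (B *\<^sub>v unit_vec n (n - 1)) i = vec_index (0\<^sub>v n) i" by (simp only: last)
  qed (use B in simp)
  moreover have "unit_vec n (n - 1) \<in> carrier_vec n" "unit_vec n (n - 1) \<noteq> (0\<^sub>v n :: 'a Matrix.vec)"
    using unit_vec_nonzero[of "n - 1" n] len by simp_all
  ultimately have "\<exists>v. v \<in> carrier_vec n \<and> v \<noteq> 0\<^sub>v n \<and> B *\<^sub>v v = 0\<^sub>v n"
    by (intro exI[of _ "unit_vec n (n - 1)"] conjI)
  then have "det B = 0" by (rule iffD2[OF det_0_iff_vec_prod_zero_field[OF B]])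
  then have "det (transpose_mat B) = 0" using det_transpose[OF B] by simp
  moreover have Bt: "transpose_mat B \<in> carrier_mat n n" using B by simp
  ultimately have "\<exists>v. v \<in> carrier_vec n \<and> v \<noteq> 0\<^sub>v n \<and> transpose_mat B *\<^sub>v v = 0\<^sub>v n"
    by (simp only: det_0_iff_vec_prod_zero_field[OF Bt])
  then obtain v where v: "v \<in> carrier_vec n" "v \<noteq> 0\<^sub>v n" "transpose_mat B *\<^sub>v v = 0\<^sub>v n"
    by blast
  have "Matrix.scalar_prod v x = 0" if x: "x \<in> S" for x
  proof -
    obtain i where i: "i < length xs" "x = xs ! i" using x unfolding xs(1)[symmetric] in_set_conv_nth by blast
    then have "i < n" using len by simp
    have "ys ! i = xs ! i" using i(1) by (simp add: ys_def nth_append)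
    then have col_x: "x = col B i" using col[OF \<open>i < n\<close>] i(2) by (simp only:)
    have "x \<in> carrier_vec n" using S(1) x by blast
    then have "Matrix.scalar_prod v x = Matrix.scalar_prod x v" by (rule comm_scalar_prod[OF v(1)])
    also have "\<dots> = vec_index (transpose_mat B *\<^sub>v v) i"
      unfolding col_x using B \<open>i < n\<close> by simp
    also have "\<dots> = 0" unfolding v(3) using \<open>i < n\<close> by simp
    finally show ?thesis .
  qed
  then show ?thesis using v by blast
qed

text \<open>If a maximal independent set of columns has fewer than \<open>n\<close> members, some non-zero vector is orthogonal
  to it, hence to its span, which contains all columns.\<close>

lemma (in vec_space) full_row_rank_iff:
  assumes A: "A \<in> carrier_mat n nc"
  shows "rank A = n \<longleftrightarrow>
    (\<forall>v\<in>carrier_vec n. (\<forall>x\<in>set (cols A). Matrix.scalar_prod v x = 0) \<longrightarrow> v = 0\<^sub>v n)"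
proof -
  let ?P = "\<lambda>T. T \<subseteq> set (cols A) \<and> lin_indpt T"
  have "\<exists>S. finite S \<and> maximal S ?P \<and> {} \<subseteq> S"
  proof (rule maximal_exists_superset[of "set (cols A)"])
    show "{} \<subseteq> set (cols A) \<and> lin_indpt {}" using finite_lin_indpt2[of "{}"] by simp
  qed simp_all
  then obtain S where S: "maximal S ?P" by blast
  have "S \<subseteq> set (cols A)" and indpt: "lin_indpt S" using S unfolding maximal_def by blast+
  have cols: "set (cols A) \<subseteq> carrier_vec n" using cols_dim A by blast
  have Sn: "S \<subseteq> carrier_vec n" and fin: "finite S"
    using \<open>S \<subseteq> set (cols A)\<close> cols finite_subset[of S] by auto
  have rank: "rank A = card S" by (rule rank_card_indpt[OF A S])
  have orth: "span S \<subseteq> {w \<in> carrier_vec n. Matrix.scalar_prod v w = 0}"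
    if v: "v \<in> carrier_vec n" "\<forall>x\<in>S. Matrix.scalar_prod v x = 0" for v
  proof (rule span_is_subset)
    show "S \<subseteq> {w \<in> carrier_vec n. Matrix.scalar_prod v w = 0}" using Sn v(2) by blast
  qed (rule submodule_orthogonal[OF v(1)])
  show ?thesis
  proof
    assume "rank A = n"
    then have "basis S"
      using dim_li_is_basis[OF fin_dim fin _ indpt] Sn rank dim_is_n by simp
    then have gen: "span S = carrier_vec n" unfolding basis_def by simp
    show "\<forall>v\<in>carrier_vec n. (\<forall>x\<in>set (cols A). Matrix.scalar_prod v x = 0) \<longrightarrow> v = 0\<^sub>v n"
    proof (intro ballI impI)
      fix v assume v: "v \<in> carrier_vec n" "\<forall>x\<in>set (cols A). Matrix.scalar_prod v x = 0"
      then have sub: "carrier_vec n \<subseteq> {w \<in> carrier_vec n. Matrix.scalar_prod v w = 0}"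
        using orth[of v] gen \<open>S \<subseteq> set (cols A)\<close> by auto
      show "v = 0\<^sub>v n"
      proof (rule eq_vecI)
        fix i assume "i < dim_vec (0\<^sub>v n :: 'a Matrix.vec)"
        then have "i < n" by simp
        have "unit_vec n i \<in> carrier_vec n" by simp
        then have "Matrix.scalar_prod v (unit_vec n i) = 0" using sub by blast
        then show "vec_index v i = vec_index (0\<^sub>v n) i"
          using v(1) \<open>i < n\<close> by (simp add: scalar_prod_right_unit)
      qed (use v in simp)
    qed
  next
    assume ker: "\<forall>v\<in>carrier_vec n. (\<forall>x\<in>set (cols A). Matrix.scalar_prod v x = 0) \<longrightarrow> v = 0\<^sub>v n"
    have "card S \<le> n" using li_le_dim(2)[OF fin_dim _ indpt] Sn dim_is_n by simp
    moreover have "\<not> card S < n"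
    proof
      assume "card S < n"
      then obtain v where v: "v \<in> carrier_vec n" "v \<noteq> 0\<^sub>v n" "\<forall>x\<in>S. Matrix.scalar_prod v x = 0"
        using orthogonal_vector_exists[OF Sn fin] by blast
      have "x \<in> span S" if x: "x \<in> set (cols A)" for x
      proof (rule ccontr)
        assume nx: "x \<notin> span S"
        have xS: "x \<notin> S" using nx in_own_span[of S] Sn by auto
        have xc: "x \<in> carrier_vec n" using x cols by auto
        have "lin_indpt (S \<union> {x})"
          using lin_dep_iff_in_span[OF Sn indpt xc xS] nx by simp
        then have "?P (S \<union> {x})" using x \<open>S \<subseteq> set (cols A)\<close> by simp
        then have "S \<union> {x} = S" using S unfolding maximal_def by blast
        then show False using xS by blast
      qed
      then have "\<forall>x\<in>set (cols A). Matrix.scalar_prod v x = 0" using orth[OF v(1,3)] by blast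
      then show False using ker v(1,2) by blast
    qed
    ultimately show "rank A = n" using rank by simp
  qed
qed

lemma mat_rank_eq_dim_row_iff:
  "mat_rank A = dim_row A \<longleftrightarrow>
    (\<forall>c. (\<forall>j<dim_col A. (\<Sum>i<dim_row A. c i * A $$ (i, j)) = 0) \<longrightarrow> (\<forall>i<dim_row A. c i = 0))"
    (is "_ \<longleftrightarrow> ?R")
proof -
  have A: "A \<in> carrier_mat (dim_row A) (dim_col A)" by simp
  have sp: "Matrix.scalar_prod v (col A j) = (\<Sum>i<dim_row A. vec_index v i * A $$ (i, j))"
    if "j < dim_col A" for v j
    using that by (simp add: scalar_prod_def atLeast0LessThan)
  have "?R \<longleftrightarrow> (\<forall>v\<in>carrier_vec (dim_row A). (\<forall>x\<in>set (cols A). Matrix.scalar_prod v x = 0)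
      \<longrightarrow> v = 0\<^sub>v (dim_row A))" (is "_ \<longleftrightarrow> ?V")
  proof
    assume R: ?R
    show ?V
    proof (intro ballI impI)
      fix v assume v: "v \<in> carrier_vec (dim_row A)" "\<forall>x\<in>set (cols A). Matrix.scalar_prod v x = 0"
      have "(\<Sum>i<dim_row A. vec_index v i * A $$ (i, j)) = 0" if j: "j < dim_col A" for j
        using v(2) j sp[OF j, of v] by (simp add: cols_def)
      then have "\<forall>i<dim_row A. vec_index v i = 0" using R[THEN spec[of _ "vec_index v"]] by blast
      then show "v = 0\<^sub>v (dim_row A)" using v(1) by (intro eq_vecI) auto
    qed
  next
    assume V: ?V
    show ?R
    proof (intro allI impI)
      fix c i assume c: "\<forall>j<dim_col A. (\<Sum>i<dim_row A. c i * A $$ (i, j)) = 0" and i: "i < dim_row A"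
      define v where "v = Matrix.vec (dim_row A) c"
      have "Matrix.scalar_prod v (col A j) = 0" if j: "j < dim_col A" for j
        using c j unfolding sp[OF j] v_def by simp
      then have "\<forall>x\<in>set (cols A). Matrix.scalar_prod v x = 0" by (auto simp: cols_def)
      moreover have "v \<in> carrier_vec (dim_row A)" by (simp add: v_def)
      ultimately have "v = 0\<^sub>v (dim_row A)" using V by blast
      then have "vec_index v i = 0" using i by simp
      then show "c i = 0" using i by (simp add: v_def)
    qed
  qed
  then show ?thesis unfolding mat_rank_def vec_space.full_row_rank_iff[OF A] by blast
qed

section \<open>Counting multi-indices\<close>

lemma mi_deg_add: "mi_deg (a + b) = mi_deg a + mi_deg b"
  by (simp add: mi_deg_def lookup_add sum.distrib)

lemma mi_deg_single [simp]: "mi_deg (mterm i k) = k"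
proof -
  have "mi_deg (mterm i k) = (\<Sum>j\<in>UNIV. if j = i then k else 0)"
    unfolding mi_deg_def by (rule sum.cong) (auto simp: lookup_single when_def)
  then show ?thesis by simp
qed

lemma mi_deg_eq_0_iff: "mi_deg a = 0 \<longleftrightarrow> a = 0"
  unfolding mi_deg_def by (auto intro: poly_mapping_eqI)

lemma mi_deg_1:
  assumes "mi_deg a = 1"
  shows "\<exists>i. a = mterm i 1"
proof -
  obtain i where i: "lk a i \<noteq> 0" using assms mi_deg_eq_0_iff[of a] poly_mapping_eqI[of a 0] by auto
  have "a = mterm i 1 + (a - mterm i 1)"
    using i by (intro poly_mapping_eqI) (auto simp: lookup_add lookup_minus lookup_single when_def)
  then have "mi_deg (a - mterm i 1) = 0"
    using assms mi_deg_add[of "mterm i 1" "a - mterm i 1"] by simp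
  then show ?thesis using \<open>a = mterm i 1 + (a - mterm i 1)\<close> unfolding mi_deg_eq_0_iff by auto
qed

text \<open>Recording the slack \<open>k - |b|\<close> as one more entry turns multi-indices of degree at most \<open>k\<close> into lists
  with sum exactly \<open>k\<close>, for which the count is known.\<close>

lemma bij_betw_mindex_lists:
  fixes k :: nat
  defines "xs \<equiv> sorted_list_of_set (UNIV :: 's::{finite,linorder} set)"
  shows "bij_betw (\<lambda>b. (k - mi_deg b) # map (lk b) xs) {b :: 's mindex. mi_deg b \<le> k}
    {l. length l = Suc CARD('s) \<and> sum_list l = k}"
proof -
  have xs: "set xs = UNIV" "distinct xs" "length xs = CARD('s)" by (simp_all add: xs_def)
  have deg: "mi_deg b = sum_list (map (lk b) xs)" for b :: "'s mindex"
    unfolding mi_deg_def using sum.distinct_set_conv_list[OF xs(2), of "lk b"] xs(1) by simp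
  show ?thesis
    unfolding bij_betw_def
  proof (intro conjI equalityI subsetI)
    show "inj_on (\<lambda>b. (k - mi_deg b) # map (lk b) xs) {b :: 's mindex. mi_deg b \<le> k}"
    proof (rule inj_onI)
      fix a b :: "'s mindex" assume "(k - mi_deg a) # map (lk a) xs = (k - mi_deg b) # map (lk b) xs"
      then show "a = b" using xs(1) by (intro poly_mapping_eqI) auto
    qed
  next
    fix l assume "l \<in> (\<lambda>b. (k - mi_deg b) # map (lk b) xs) ` {b :: 's mindex. mi_deg b \<le> k}"
    then show "l \<in> {l. length l = Suc CARD('s) \<and> sum_list l = k}"
      by (auto simp: xs(3) deg)
  next
    fix l assume l: "l \<in> {l. length l = Suc CARD('s) \<and> sum_list l = k}"
    then obtain a t where t: "l = a # t" by (cases l) auto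
    define b :: "'s mindex" where "b = Abs_poly_mapping (\<lambda>i. t ! the_inv_into {..<CARD('s)} ((!) xs) i)"
    have "lk b (xs ! i) = t ! i" if "i < CARD('s)" for i
      unfolding b_def using that xs
      by (simp add: the_inv_into_f_f inj_on_nth)
    then have tb: "map (lk b) xs = t" using l t xs(3) by (intro nth_equalityI) auto
    then have "mi_deg b = sum_list t" by (simp add: deg)
    then have "mi_deg b \<le> k" "l = (k - mi_deg b) # map (lk b) xs" using l t tb by auto
    then show "l \<in> (\<lambda>b. (k - mi_deg b) # map (lk b) xs) ` {b :: 's mindex. mi_deg b \<le> k}" by blast
  qed
qed

lemma card_mindex_le: "card {b :: 's::{finite,linorder} mindex. mi_deg b \<le> k} = (k + CARD('s)) choose CARD('s)"
  using bij_betw_same_card[OF bij_betw_mindex_lists[where 's = 's, of k]]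
    binomial_symmetric[of k "k + CARD('s)"]
  by (simp add: card_length_sum_list)

lemma finite_mindex_le: "finite {b :: 's::{finite,linorder} mindex. mi_deg b \<le> k}"
  by (rule card_ge_0_finite) (simp add: card_mindex_le)

lemma card_mindex_between:
  "card {a :: 's::{finite,linorder} mindex. 1 \<le> mi_deg a \<and> mi_deg a \<le> k} = ((k + CARD('s)) choose CARD('s)) - 1"
proof -
  have "{a :: 's mindex. 1 \<le> mi_deg a \<and> mi_deg a \<le> k} = {a. mi_deg a \<le> k} - {0}"
    by (auto simp: Suc_le_eq mi_deg_eq_0_iff simp flip: neq0_conv)
  moreover have "card ({a :: 's mindex. mi_deg a \<le> k} - {0}) = card {a :: 's mindex. mi_deg a \<le> k} - 1"
    by (rule card_Diff_singleton) (simp add: mi_deg_def)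
  ultimately show ?thesis by (simp only: card_mindex_le)
qed

lemma finite_mindex_between: "finite {a :: 's::{finite,linorder} mindex. 1 \<le> mi_deg a \<and> mi_deg a \<le> k}"
  by (rule finite_subset[OF _ finite_mindex_le[of k]]) auto

lemma grlex_list:
  fixes S :: "'s::{finite,linorder} mindex set"
  assumes "finite S"
  shows "set (grlex_list S) = S" "distinct (grlex_list S)" "length (grlex_list S) = card S"
proof -
  have *: "sorted_wrt grlex_less (grlex_list S) \<and> set (grlex_list S) = S"
    unfolding grlex_list_def by (rule theI'[OF grlex_list_ex1[OF assms]])
  then show "set (grlex_list S) = S" ..
  have irrefl: "\<not> grlex_less a a" for a :: "'s mindex" by (simp add: grlex_less_def)
  have "distinct l" if "sorted_wrt grlex_less l" for l :: "'s mindex list"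
    using that by (induction l) (use irrefl in auto)
  then show "distinct (grlex_list S)" using * by blast
  then show "length (grlex_list S) = card S" using * distinct_card[of "grlex_list S"] by simp
qed

section \<open>The rank of the Jacobian matrix\<close>

lemma jac_entry_eval:
  "poly_eval (jac_entry F b a) p =
    (if mi_le b a then of_nat (mi_fact b) * of_nat (mi_binomial a b) / of_nat (mi_fact a)
      * poly_eval (mi_deriv (a - b) F) p else 0)"
  by (simp add: jac_entry_def)

lemma mi_deriv_zero: "mi_deriv 0 F = F"
proof -
  have "foldr (\<lambda>i. partial_deriv i ^^ lk 0 i) l F = F" for l by (induction l) simp_all
  then show ?thesis by (simp add: mi_deriv_def)
qed

lemma mi_deriv_single:
  fixes F :: "'s::{finite,linorder} cpoly"
  shows "mi_deriv (mterm i 1) F = partial_deriv i F"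
proof -
  have other: "foldr (\<lambda>j. partial_deriv j ^^ lk (mterm i 1) j) l F = F" if "i \<notin> set l" for l
    using that by (induction l) (auto simp: lookup_single)
  have "foldr (\<lambda>j. partial_deriv j ^^ lk (mterm i 1) j) l F = partial_deriv i F"
    if "i \<in> set l" "distinct l" for l
    using that
  proof (induction l)
    case (Cons a l)
    show ?case
    proof (cases "a = i")
      case True
      then show ?thesis using Cons.prems other[of l] by simp
    next
      case False
      then show ?thesis using Cons by (simp add: lookup_single)
    qed
  qed simp
  then show ?thesis unfolding mi_deriv_def by simp
qed

lemma jac_entry_coeff_nonzero:
  assumes "mi_le b a"
  shows "of_nat (mi_fact b) * of_nat (mi_binomial a b) / of_nat (mi_fact a) \<noteq> (0 :: complex)"
proof -
  have "mi_fact b \<noteq> 0" "mi_fact a \<noteq> 0" by (simp_all add: mi_fact_def)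
  moreover have "mi_binomial a b \<noteq> 0" using assms by (simp add: mi_binomial_def mi_le_def not_less)
  ultimately show ?thesis by simp
qed

lemma mi_le_add_diff: "mi_le b a \<Longrightarrow> a = b + (a - b)"
  by (rule poly_mapping_eqI) (simp add: mi_le_def lookup_add lookup_minus)

lemma mi_le_add: "mi_le b (b + c)"
  by (simp add: mi_le_def lookup_add)

text \<open>Think of \<open>v\<close> as the polynomial \<open>V = \<Sum> v\<^sub>b (x - p)\<^sup>b\<close>; the relations say that \<open>V F\<close> has no terms of degree
  \<open>1\<close> to \<open>n\<close>. Let \<open>d\<close> be the lowest degree in \<open>V\<close>. The part of degree \<open>d + 1\<close> of \<open>V F\<close> is the part of degree \<open>d\<close> of \<open>V\<close>
  times the linear part of \<open>F\<close>, which contains \<open>x\<^sub>j - p\<^sub>j\<close>. Among the terms of degree \<open>d\<close> choose \<open>b0\<close> with the largest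
  exponent of \<open>x\<^sub>j\<close>: the monomial \<open>b0 + j\<close> arises in the product only from \<open>b0\<close> and \<open>x\<^sub>j - p\<^sub>j\<close>, so its
  coefficient is not zero.\<close>

theorem left_kernel_trivial:
  fixes F :: "'s::{finite,linorder} cpoly"
  assumes "n \<ge> 1" "poly_eval F p = 0" and j: "poly_eval (partial_deriv j F) p \<noteq> 0"
    and rel: "\<And>a. 1 \<le> mi_deg a \<Longrightarrow> mi_deg a \<le> n \<Longrightarrow>
      (\<Sum>b\<in>{b. mi_deg b \<le> n - 1}. v b * poly_eval (jac_entry F b a) p) = 0"
    and "mi_deg b \<le> n - 1"
  shows "v b = 0"
proof (rule ccontr)
  assume "v b \<noteq> 0"
  let ?B = "{b :: 's mindex. mi_deg b \<le> n - 1}"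
  define d where "d = (LEAST d. \<exists>b\<in>?B. v b \<noteq> 0 \<and> mi_deg b = d)"
  have "\<exists>d. \<exists>b\<in>?B. v b \<noteq> 0 \<and> mi_deg b = d" using \<open>v b \<noteq> 0\<close> assms(5) by blast
  then have d: "\<exists>b\<in>?B. v b \<noteq> 0 \<and> mi_deg b = d" unfolding d_def by (rule LeastI_ex)
  have low: "v c = 0" if "c \<in> ?B" "mi_deg c < d" for c
    using not_less_Least[of "mi_deg c" "\<lambda>d. \<exists>b\<in>?B. v b \<noteq> 0 \<and> mi_deg b = d"] that
    unfolding d_def by blast
  define D where "D = {b\<in>?B. v b \<noteq> 0 \<and> mi_deg b = d}"
  have "finite D" unfolding D_def by (rule finite_subset[OF _ finite_mindex_le[of "n - 1"]]) auto
  then have fin: "finite ((\<lambda>c. lk c j) ` D)" by (rule finite_imageI)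
  have "D \<noteq> {}" using d unfolding D_def by blast
  then have "Max ((\<lambda>c. lk c j) ` D) \<in> (\<lambda>c. lk c j) ` D" using Max_in[OF fin] by blast
  then obtain b0 where b0: "b0 \<in> D" and Max: "Max ((\<lambda>c. lk c j) ` D) = lk b0 j" by blast
  have max: "lk c j \<le> lk b0 j" if "c \<in> D" for c
    using Max_ge[OF fin, of "lk c j"] that unfolding Max by blast
  define a where "a = b0 + mterm j 1"
  have a: "mi_deg a = Suc d" using b0 by (simp add: a_def D_def mi_deg_add)
  have "d \<le> n - 1" using b0 by (auto simp: D_def)
  have zero: "v c * poly_eval (jac_entry F c a) p = 0" if c: "c \<in> ?B" "c \<noteq> b0" for c
  proof (rule ccontr)
    assume nz: "v c * poly_eval (jac_entry F c a) p \<noteq> 0"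
    then have vc: "v c \<noteq> 0" and le: "mi_le c a" and der: "poly_eval (mi_deriv (a - c) F) p \<noteq> 0"
      by (auto simp: jac_entry_eval split: if_splits)
    have ac: "a = c + (a - c)" by (rule mi_le_add_diff[OF le])
    have sum: "mi_deg c + mi_deg (a - c) = Suc d" using a ac mi_deg_add[of c "a - c"] by simp
    moreover have "d \<le> mi_deg c" using low[OF c(1)] vc by (meson not_le)
    moreover have "mi_deg (a - c) \<noteq> 0"
      using der assms(2) by (auto simp: mi_deg_eq_0_iff mi_deriv_zero)
    ultimately have "mi_deg (a - c) = 1" "mi_deg c = d" by simp_all
    then obtain i where i: "a - c = mterm i 1" using mi_deg_1 by blast
    have "c \<in> D" using c(1) vc \<open>mi_deg c = d\<close> by (simp add: D_def)
    \<comment> \<open>From \<open>b0 + j = c + i\<close> with \<open>i \<noteq> j\<close> the exponent of \<open>x\<^sub>j\<close> in \<open>c\<close> would exceed that in \<open>b0\<close>.\<close>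
    then have "lk c j \<le> lk b0 j" by (rule max)
    moreover have "lk b0 j + 1 = lk c j + lk (mterm i (1::nat)) j"
      using ac i unfolding a_def by (metis lookup_add lookup_single_eq)
    ultimately have "i = j" by (cases "i = j") (simp_all add: lookup_single)
    then have "b0 = c" using ac i unfolding a_def by simp
    then show False using c(2) by simp
  qed
  have "(\<Sum>c\<in>?B. v c * poly_eval (jac_entry F c a) p) = (\<Sum>c\<in>{b0}. v c * poly_eval (jac_entry F c a) p)"
    using b0 zero finite_mindex_le by (intro sum.mono_neutral_right) (auto simp: D_def)
  then have "v b0 * poly_eval (jac_entry F b0 a) p = 0"
    using rel[of a] a \<open>d \<le> n - 1\<close> assms(1) by simp
  moreover have "poly_eval (jac_entry F b0 a) p \<noteq> 0"
  proof -
    have "mi_le b0 a" unfolding a_def by (rule mi_le_add)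
    moreover have "a - b0 = mterm j 1" by (simp add: a_def)
    ultimately show ?thesis
      using jac_entry_coeff_nonzero j unfolding jac_entry_eval by (simp only: mi_deriv_single mult_eq_0_iff if_True de_Morgan_disj) simp
  qed
  ultimately show False using b0 by (simp add: D_def)
qed

text \<open>Within degree \<open>n\<close> such a row involves only \<open>F(p)\<close> and first derivatives.\<close>

lemma top_row_zero:
  fixes F :: "'s::{finite,linorder} cpoly"
  assumes "poly_eval F p = 0" "\<And>j. poly_eval (partial_deriv j F) p = 0"
    and "mi_deg a \<le> n" "mi_deg b = n - 1"
  shows "poly_eval (jac_entry F b a) p = 0"
proof (cases "mi_le b a")
  case True
  then have "mi_deg b + mi_deg (a - b) = mi_deg a" using mi_le_add_diff mi_deg_add by metis
  then have "mi_deg (a - b) = 0 \<or> mi_deg (a - b) = 1" using assms(3,4) by linarith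
  then have "poly_eval (mi_deriv (a - b) F) p = 0"
  proof
    assume "mi_deg (a - b) = 0"
    then show ?thesis using assms(1) by (simp add: mi_deg_eq_0_iff mi_deriv_zero)
  next
    assume "mi_deg (a - b) = 1"
    then obtain i where "a - b = mterm i 1" using mi_deg_1 by blast
    then show ?thesis using assms(2) by (simp only: mi_deriv_single)
  qed
  then show ?thesis by (simp add: jac_entry_eval)
qed (simp add: jac_entry_eval)

text \<open>The number of columns in the definition of the Jacobian matrix is given as a
  binomial coefficient; it agrees with the length of the rows by counting multi-indices.\<close>

lemma Jac_at_simps:
  fixes F :: "'s::{finite,linorder} cpoly" and n :: nat
  defines "bs \<equiv> grlex_list {b :: 's mindex. mi_deg b \<le> n - 1}"
    and "as \<equiv> grlex_list {a :: 's mindex. 1 \<le> mi_deg a \<and> mi_deg a \<le> n}"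
  shows "dim_row (Jac_at n F p) = length bs" "dim_col (Jac_at n F p) = length as"
    "\<And>i j. i < length bs \<Longrightarrow> j < length as \<Longrightarrow>
      Jac_at n F p $$ (i, j) = poly_eval (jac_entry F (bs ! i) (as ! j)) p"
proof -
  have as: "length as = ((n + CARD('s)) choose CARD('s)) - 1"
    unfolding as_def grlex_list(3)[OF finite_mindex_between] card_mindex_between ..
  show "dim_row (Jac_at n F p) = length bs" "dim_col (Jac_at n F p) = length as"
    by (simp_all add: Jac_at_def Jac_def bs_def as)
  show "Jac_at n F p $$ (i, j) = poly_eval (jac_entry F (bs ! i) (as ! j)) p"
    if "i < length bs" "j < length as" for i j
    using that as unfolding bs_def as_def
    by (simp add: Jac_at_def Jac_def mat_of_rows_index jac_row_def vec_of_list_index)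
qed

theorem mat_rank_Jac_at_iff:
  fixes F :: "'s::{finite,linorder} cpoly"
  assumes n: "n \<ge> 1" and F: "poly_eval F p = 0"
  shows "mat_rank (Jac_at n F p) = (n + CARD('s) - 1) choose CARD('s) \<longleftrightarrow>
    (\<exists>j. poly_eval (partial_deriv j F) p \<noteq> 0)"
proof -
  let ?B = "{b :: 's mindex. mi_deg b \<le> n - 1}"
  define bs where "bs = grlex_list ?B"
  define as where "as = grlex_list {a :: 's mindex. 1 \<le> mi_deg a \<and> mi_deg a \<le> n}"
  note J = Jac_at_simps[where n = n and F = F and p = p, folded bs_def as_def]
  have bs: "set bs = ?B" "distinct bs" "length bs = (n + CARD('s) - 1) choose CARD('s)"
    using grlex_list[OF finite_mindex_le[where 's = 's, of "n - 1"]] n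
    by (simp_all add: bs_def card_mindex_le)
  have as: "set as = {a. 1 \<le> mi_deg a \<and> mi_deg a \<le> n}"
    unfolding as_def by (rule grlex_list(1)[OF finite_mindex_between])
  have rank: "mat_rank (Jac_at n F p) = (n + CARD('s) - 1) choose CARD('s) \<longleftrightarrow>
    (\<forall>c. (\<forall>j<length as. (\<Sum>i<length bs. c i * poly_eval (jac_entry F (bs ! i) (as ! j)) p) = 0)
      \<longrightarrow> (\<forall>i<length bs. c i = 0))"
    using mat_rank_eq_dim_row_iff[of "Jac_at n F p"] bs(3) by (simp add: J)
  show ?thesis
  proof
    assume "mat_rank (Jac_at n F p) = (n + CARD('s) - 1) choose CARD('s)"
    then have ker: "\<forall>j<length as. (\<Sum>i<length bs. c i * poly_eval (jac_entry F (bs ! i) (as ! j)) p) = 0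
      \<Longrightarrow> \<forall>i<length bs. c i = 0" for c using rank by blast
    show "\<exists>j. poly_eval (partial_deriv j F) p \<noteq> 0"
    proof (rule ccontr)
      assume grad: "\<not> (\<exists>j. poly_eval (partial_deriv j F) p \<noteq> 0)"
      obtain i0 :: 's where True by blast
      have "mterm i0 (n - 1) \<in> set bs" by (simp add: bs)
      then obtain r where r: "r < length bs" "bs ! r = mterm i0 (n - 1)" by (metis in_set_conv_nth)
      have "\<forall>j<length as. (\<Sum>i<length bs. (if i = r then 1 else 0) * poly_eval (jac_entry F (bs ! i) (as ! j)) p) = 0"
      proof (intro allI impI)
        fix j assume "j < length as"
        then have "as ! j \<in> set as" by simp
        then have "mi_deg (as ! j) \<le> n" by (simp add: as)
        then have "poly_eval (jac_entry F (bs ! r) (as ! j)) p = 0"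
          using grad F by (intro top_row_zero[where n = n]) (simp_all add: r)
        then show "(\<Sum>i<length bs. (if i = r then 1 else 0) * poly_eval (jac_entry F (bs ! i) (as ! j)) p) = 0"
          by (intro sum.neutral) simp
      qed
      then have "(if r = r then 1 else 0) = (0::complex)" using ker[of "\<lambda>i. if i = r then 1 else 0"] r(1) by blast
      then show False by simp
    qed
  next
    assume "\<exists>j. poly_eval (partial_deriv j F) p \<noteq> 0"
    then obtain j where j: "poly_eval (partial_deriv j F) p \<noteq> 0" ..
    show "mat_rank (Jac_at n F p) = (n + CARD('s) - 1) choose CARD('s)"
      unfolding rank
    proof (intro allI impI)
      fix c i
      assume c: "\<forall>j<length as. (\<Sum>i<length bs. c i * poly_eval (jac_entry F (bs ! i) (as ! j)) p) = 0"
        and i: "i < length bs"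
      define v where "v b = c (the_inv_into {..<length bs} ((!) bs) b)" for b
      have v: "v (bs ! i) = c i" if "i < length bs" for i
        unfolding v_def using that bs(2) by (simp add: the_inv_into_f_f inj_on_nth)
      have bij: "bij_betw ((!) bs) {..<length bs} ?B" by (rule bij_betw_nth[OF bs(2)]) (simp_all add: bs)
      have "v (bs ! i) = 0"
      proof (rule left_kernel_trivial[OF n F j])
        show "mi_deg (bs ! i) \<le> n - 1" using nth_mem[OF i] by (simp add: bs)
        fix a :: "'s mindex" assume "1 \<le> mi_deg a" "mi_deg a \<le> n"
        then have "a \<in> set as" by (simp add: as)
        then obtain k where k: "k < length as" "a = as ! k" by (metis in_set_conv_nth)
        have "(\<Sum>b\<in>?B. v b * poly_eval (jac_entry F b a) p)
            = (\<Sum>i<length bs. v (bs ! i) * poly_eval (jac_entry F (bs ! i) a) p)"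
          by (rule sum.reindex_bij_betw[OF bij, symmetric])
        also have "\<dots> = (\<Sum>i<length bs. c i * poly_eval (jac_entry F (bs ! i) a) p)"
          by (rule sum.cong) (simp_all add: v)
        also have "\<dots> = 0" using c k by simp
        finally show "(\<Sum>b\<in>?B. v b * poly_eval (jac_entry F b a) p) = 0" .
      qed
      then show "c i = 0" using v[OF i] by simp
    qed
  qed
qed

theorem theorem2p1:
  fixes F :: "'s::{finite,linorder} cpoly" and p :: "complex ^ ('s::{finite,linorder})" and n :: nat
  assumes "n \<ge> 1"
    and "squarefree F"
    and "\<forall>c. F \<noteq> const_poly c"
    and "p \<in> zero_set {F}"
  shows "nonsingular_point (zero_set {F}) p \<longleftrightarrow>
    mat_rank (Jac_at n F p) = (n + CARD('s) - 1) choose CARD('s)"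
proof -
  have F0: "F \<noteq> 0"
  proof
    assume "F = 0"
    then have "F = const_poly 0" by simp
    then show False using assms(3) by blast
  qed
  have Fp: "poly_eval F p = 0" using assms(4) by (simp add: zero_set_def)
  show ?thesis
    unfolding nonsingular_point_hypersurface_iff[OF assms(2) F0 Fp] mat_rank_Jac_at_iff[OF assms(1) Fp] ..
qed

end
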